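(* Let $n\ge 2$, let $m\ge 0$ and $0\le k\le m$ be integers, and let $f\in\mathcal{S}(S^m)$ be a symmetric $m$-tensor field on $\mathbb{R}^n$ with Schwartz components. Then $\mathcal{I}^k f=0$ if and only if $W^k f=0$. That is, the operators $\mathcal{I}^k$ and $W^k$ have the same kernel in $\mathcal{S}(S^m)$.
   Context: Notation. $\mathcal{S}(S^m)$ is the space of covariant symmetric $m$-tensor fields $f=f_{i_1\dots i_m}(x)\,dx^{i_1}\cdots dx^{i_m}$ on $\mathbb{R}^n$ whose components $f_{i_1\dots i_m}$ (symmetric in all indices) belong to the Schwartz space $\mathcal{S}(\mathbb{R}^n)$. Indices run from $1$ to $n$. The Einstein summation convention is used for repeated indices, and upper and lower indices are not distinguished (Euclidean metric). $S^m$ denotes the space of symmetric $m$-tensors on $\mathbb{R}^n$, and $C^\infty(S^m)$ the smooth symmetric $m$-tensor fields. Integral moment transforms. Let $T\mathbb{S}^{n-1}=\{(x,\xi)\in\mathbb{R}^n\times\mathbb{R}^n : |\xi|=1,\ \langle x,\xi\rangle=0\}$. For an integer $q\ge 0$, the $q$-th integral moment transform of $f\in\mathcal{S}(S^m)$ is the function on $T\mathbb{S}^{n-1}$ $$(I^q f)(x,\xi)=\int_{-\infty}^{\infty} t^q f_{i_1\dots i_m}(x+t\xi)\,\xi^{i_1}\cdots\xi^{i_m}\,dt .$$ Set $\mathcal{I}^k f=(I^0 f, I^1 f,\dots, I^k f)$ on $T\mathbb{S}^{n-1}$. Symmetrization. $\sigma(a_1\dots a_r)$ denotes symmetrization over the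 listed indices: the average, over all $r!$ permutations of the indices $a_1,\dots,a_r$, of the expression that follows it. Generalized Saint Venant operator. For fixed $i_1,\dots,i_k$, let $f^{i_1\cdots i_k}$ be the symmetric $(m-k)$-tensor field with components $f^{i_1\cdots i_k}_{j_1\dots j_{m-k}}=f_{i_1\dots i_k j_1\dots j_{m-k}}$. For $0\le k\le m$, the generalized Saint Venant operator $W^k:C^\infty(S^m)\to C^\infty(S^{m-k}\otimes S^{m})$ is $$(W^k f)_{p_1\dots p_{m-k}q_1\dots q_{m-k}i_1\dots i_k}=\sigma(p_1\dots p_{m-k})\,\sigma(q_1\dots q_{m-k}\,i_1\dots i_k)\sum_{\ell=0}^{m-k}(-1)^\ell\binom{m-k}{\ell}\frac{\partial^{m-k} f^{i_1\dots i_k}_{p_1\dots p_{m-k-\ell}\,q_1\dots q_\ell}}{\partial x^{p_{m-k-\ell+1}}\cdots\partial x^{p_{m-k}}\,\partial x^{q_{\ell+1}}\cdots\partial x^{q_{m-k}}} .$$ *)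

theory Defs
  imports "HOL-Analysis.Analysis" "HOL-Combinatorics.Permutations"
begin

text \<open>
  Points of n-space are vectors in \<open>real ^ 'n\<close>, and an element of \<open>'n\<close> is a coordinate index.
  A tensor field of rank \<open>m\<close> is given by its components \<open>f is\<close>, where \<open>is\<close> is the list of the
  \<open>m\<close> indices; values at lists of any other length are irrelevant junk. Scalars are of sort
  \<open>{real_normed_field, euclidean_space}\<close>, which covers both real and complex components.
\<close>

type_synonym ('n, 'a) tensor_field = "'n list \<Rightarrow> real ^ 'n \<Rightarrow> 'a"

definition partial :: "'n::finite \<Rightarrow> (real ^ 'n \<Rightarrow> 'a::real_normed_vector) \<Rightarrow> real ^ 'n \<Rightarrow> 'a" where
  "partial i u x = frechet_derivative u (at x) (axis i 1)"

fun partials :: "'n::finite list \<Rightarrow> (real ^ 'n \<Rightarrow> 'a::real_normed_vector) \<Rightarrow> real ^ 'n \<Rightarrow> 'a" where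
  "partials [] u = u"
| "partials (i # is) u = partial i (partials is u)"

definition smooth :: "(real ^ 'n::finite \<Rightarrow> 'a::real_normed_vector) \<Rightarrow> bool" where
  "smooth u \<longleftrightarrow> (\<forall>is x. partials is u differentiable (at x))"

definition schwartz :: "(real ^ 'n::finite \<Rightarrow> 'a::real_normed_vector) \<Rightarrow> bool" where
  "schwartz u \<longleftrightarrow> smooth u \<and>
     (\<forall>(N::nat) is. \<exists>C. \<forall>x. norm x ^ N * norm (partials is u x) \<le> C)"

definition symmetric_tensor :: "nat \<Rightarrow> ('n, 'a) tensor_field \<Rightarrow> bool" where
  "symmetric_tensor m f \<longleftrightarrow>
     (\<forall>is \<pi>. length is = m \<longrightarrow> \<pi> permutes {..<m} \<longrightarrow> f (permute_list \<pi> is) = f is)"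

definition schwartz_tensor_fields ::
    "nat \<Rightarrow> ('n::finite, 'a::real_normed_vector) tensor_field set" where
  "schwartz_tensor_fields m =
     {f. symmetric_tensor m f \<and> (\<forall>is. length is = m \<longrightarrow> schwartz (f is))}"

definition tangent_sphere :: "((real ^ 'n::finite) \<times> (real ^ 'n)) set" where
  "tangent_sphere = {(x, \<xi>). norm \<xi> = 1 \<and> x \<bullet> \<xi> = 0}"

definition moment_transform ::
    "nat \<Rightarrow> nat \<Rightarrow> ('n::finite, 'a::{real_normed_field, euclidean_space}) tensor_field
      \<Rightarrow> (real ^ 'n) \<times> (real ^ 'n) \<Rightarrow> 'a" where
  "moment_transform m q f = (\<lambda>(x, \<xi>).
     (\<integral>t. t ^ q *\<^sub>R (\<Sum>is | length is = m. prod_list (map (\<lambda>i. \<xi> $ i) is) *\<^sub>R f is (x + t *\<^sub>R \<xi>))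
        \<partial>lborel))"

text \<open>
  Symmetrization \<open>\<sigma>(a\<^sub>1\<dots>a\<^sub>r)\<close> of an expression \<open>F\<close> in the indices \<open>as = [a\<^sub>1, \<dots>, a\<^sub>r]\<close>:
  positions, not values, are permuted, so repeated index values are counted with multiplicity.
\<close>

definition symmetrize :: "('n list \<Rightarrow> 'a::real_vector) \<Rightarrow> 'n list \<Rightarrow> 'a" where
  "symmetrize F as =
     (1 / fact (length as)) *\<^sub>R (\<Sum>\<pi> | \<pi> permutes {..<length as}. F (permute_list \<pi> as))"

definition saint_venant_sum ::
    "nat \<Rightarrow> nat \<Rightarrow> ('n::finite, 'a::real_normed_vector) tensor_field
      \<Rightarrow> 'n list \<Rightarrow> 'n list \<Rightarrow> 'n list \<Rightarrow> real ^ 'n \<Rightarrow> 'a" where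
  "saint_venant_sum m k f ps qs is x =
     (\<Sum>l\<le>m - k. ((-1) ^ l * real ((m - k) choose l)) *\<^sub>R
        partials (drop (m - k - l) ps @ drop l qs) (f (is @ take (m - k - l) ps @ take l qs)) x)"

text \<open>
  The component of \<open>W\<^sup>k f\<close> with indices \<open>ps\<close>, \<open>qs\<close> (of length \<open>m - k\<close>) and \<open>is\<close> (of length \<open>k\<close>).
  The inner symmetrization is over the concatenated index list \<open>qs @ is\<close>, which is
  split again into its first \<open>m - k\<close> and its last \<open>k\<close> entries.
\<close>

definition saint_venant ::
    "nat \<Rightarrow> nat \<Rightarrow> ('n::finite, 'a::real_normed_vector) tensor_field
      \<Rightarrow> 'n list \<Rightarrow> 'n list \<Rightarrow> 'n list \<Rightarrow> real ^ 'n \<Rightarrow> 'a" where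
  "saint_venant m k f ps qs is x =
     symmetrize (\<lambda>ps'.
       symmetrize (\<lambda>rs. saint_venant_sum m k f ps' (take (m - k) rs) (drop (m - k) rs) x)
         (qs @ is)) ps"

end

theory Submission
  imports Defs "HOL-Probability.Probability"
begin

text \<open>
  Write \<open>f(v\<^sub>1, \<dots>, v\<^sub>m)\<close> for the value of a symmetric tensor field on vectors. For linearly independent
  vectors \<open>\<eta>\<close> and \<open>\<xi>\<close>, the proof turns on the operator
  \<open>D f = \<partial>\<^sub>\<xi> f(\<eta>, \<dots>) - \<partial>\<^sub>\<eta> f(\<xi>, \<dots>)\<close>, called \<open>plane_curl\<close> below, which lowers the rank by one. It is
  bilinear and antisymmetric in \<open>\<eta>\<close> and \<open>\<xi>\<close>, so it does not change when \<open>\<xi>\<close> is replaced by \<open>\<xi> + c \<eta>\<close>.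

  \<^bold>\<open>The Saint Venant side.\<close> Let \<open>r = m - k\<close>. The two terms of \<open>D\<close> commute, hence the binomial
  theorem expands \<open>D\<^sup>r\<close> into the alternating sum that defines \<open>W\<^sup>k f\<close>: contracting the \<open>p\<close> indices of
  that sum with \<open>\<eta>\<close> and its \<open>q\<close> and \<open>i\<close> indices with \<open>\<xi>\<close> gives \<open>(D\<^sup>r f)(\<xi>, \<dots>, \<xi>)\<close>
  (\<open>saint_venant_sum_contraction\<close>). By polarization \<open>W\<^sup>k f = 0\<close> says that these scalars vanish for all
  \<open>\<eta>\<close> and \<open>\<xi>\<close>, and by continuity it is enough to know this for independent \<open>\<eta>\<close> and \<open>\<xi>\<close>.

  \<^bold>\<open>The integral side.\<close> Let \<open>J\<^sup>q f\<close> be the integral of \<open>t\<^sup>q f(\<theta>, \<dots>, \<theta>)\<close> over the line \<open>x + t \<theta>\<close>; by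
  translating and rescaling the parameter, \<open>I\<^sup>q f = 0\<close> for all \<open>q \<le> k\<close> means \<open>J\<^sup>q f = 0\<close> for all \<open>q \<le> k\<close>
  and all lines. Take directions \<open>\<theta> = \<xi> + c \<eta>\<close>. For a field \<open>f\<close> of any rank \<open>m + 1\<close>, an integration by parts along the
  line and a differentiation in \<open>c\<close> give

  \<^item> \<open>J\<^sup>q (D f) = - q J\<^sup>q\<^sup>-\<^sup>1 f(\<eta>, \<dots>) - \<partial>\<^sub>\<eta> J\<^sup>q f\<close>,
  \<^item> \<open>\<partial>\<^sub>c J\<^sup>q\<^sup>-\<^sup>1 f = \<partial>\<^sub>\<eta> J\<^sup>q f + (m + 1) J\<^sup>q\<^sup>-\<^sup>1 f(\<eta>, \<dots>)\<close>.

  If \<open>J\<^sup>q f = 0\<close> for \<open>q \<le> k\<close>, the same therefore holds for \<open>D f\<close>. Conversely, suppose that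
  \<open>J\<^sup>q (D f) = 0\<close> for \<open>q \<le> k\<close>, where \<open>k \<le> m\<close>, and that \<open>J\<^sup>q\<^sup>-\<^sup>1 f = 0\<close> is already known. Eliminating
  \<open>f(\<eta>, \<dots>)\<close> leaves \<open>(1 - q / (m + 1)) \<partial>\<^sub>\<eta> J\<^sup>q f = 0\<close>, and since \<open>q < m + 1\<close> and \<open>J\<^sup>q f\<close> decays in the direction
  \<open>\<eta>\<close>, it vanishes. Iterating, \<open>J\<^sup>q f = 0\<close> for \<open>q \<le> k\<close> if and only if \<open>J\<^sup>q (D\<^sup>r f) = 0\<close> for \<open>q \<le> k\<close>
  (\<open>pencil_moments_vanish_iff_plane_curl_power\<close>), where \<open>D\<^sup>r f\<close> has rank \<open>k\<close>.

  \<^bold>\<open>Closing the circle.\<close> If \<open>(D\<^sup>r f)(\<theta>, \<dots>, \<theta>)\<close> vanishes, so do all its moments. Conversely, the second relation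
  also passes from \<open>f\<close> to \<open>f(\<eta>, \<dots>)\<close> at the price of one moment. Spending all \<open>k\<close> moments on \<open>D\<^sup>r f\<close>, the
  scalar \<open>(D\<^sup>r f)(\<eta>, \<dots>, \<eta>)\<close> has integral zero over every line with direction \<open>\<xi> + c \<eta>\<close>, so it is zero because the
  X-ray transform of a plane is injective (\<open>plane_xray_injective\<close>). Exchanging \<open>\<eta>\<close> and \<open>\<xi>\<close>, which only changes
  the sign of \<open>D\<close>, gives the statement with \<open>\<xi>\<close>.
\<close>

section \<open>Directional derivatives\<close>

text \<open>
  Partial derivatives are the special case of coordinate vectors, but all computations below
  take place along vectors that are not coordinate vectors.
\<close>

definition dirderiv :: "real ^ 'n::finite \<Rightarrow> (real ^ 'n \<Rightarrow> 'a::real_normed_vector) \<Rightarrow> real ^ 'n \<Rightarrow> 'a" where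
  "dirderiv v u x = frechet_derivative u (at x) v"

lemma partials_append: "partials (is @ js) u = partials is (partials js u)"
  by (induction "is") auto

lemma smooth_differentiable: "smooth u \<Longrightarrow> u differentiable (at x)"
  unfolding smooth_def by (metis partials.simps(1))

lemma smooth_partials: "smooth u \<Longrightarrow> smooth (partials is u)"
  unfolding smooth_def by (metis partials_append)

lemma smooth_partial: "smooth u \<Longrightarrow> smooth (partial i u)"
  using smooth_partials[of u "[i]"] by simp

lemma smooth_has_derivative: "smooth u \<Longrightarrow> (u has_derivative (\<lambda>v. dirderiv v u x)) (at x)"
  unfolding dirderiv_def using smooth_differentiable frechet_derivative_works by blast

lemma dirderiv_eqI: "(u has_derivative u') (at x) \<Longrightarrow> dirderiv v u x = u' v"
  unfolding dirderiv_def using frechet_derivative_at by metis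

lemma dirderiv_add_direction:
  "smooth u \<Longrightarrow> dirderiv (v + w) u x = dirderiv v u x + dirderiv w u x"
  using linear_add[OF has_derivative_linear[OF smooth_has_derivative]] .

lemma dirderiv_scaleR_direction:
  "smooth u \<Longrightarrow> dirderiv (c *\<^sub>R v) u x = c *\<^sub>R dirderiv v u x"
  using linear_scale[OF has_derivative_linear[OF smooth_has_derivative]] .

lemma dirderiv_eq_sum_partial:
  assumes "smooth u"
  shows "dirderiv v u x = (\<Sum>i\<in>UNIV. v $ i *\<^sub>R partial i u x)"
proof -
  have lin: "linear (\<lambda>v. dirderiv v u x)"
    using has_derivative_linear smooth_has_derivative[OF assms] by blast
  have "v = (\<Sum>i\<in>UNIV. v $ i *\<^sub>R axis i 1)"
    by (metis (no_types, lifting) basis_expansion scalar_mult_eq_scaleR sum.cong)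
  then have "dirderiv v u x = dirderiv (\<Sum>i\<in>UNIV. v $ i *\<^sub>R axis i 1) u x" by simp
  also have "\<dots> = (\<Sum>i\<in>UNIV. v $ i *\<^sub>R dirderiv (axis i 1) u x)"
    unfolding linear_sum[OF lin] linear_scale[OF lin] ..
  finally show ?thesis by (simp add: partial_def dirderiv_def)
qed

lemma partial_lincomb:
  assumes "smooth u" "smooth v"
  shows "partial i (\<lambda>x. a *\<^sub>R u x + b *\<^sub>R v x) = (\<lambda>x. a *\<^sub>R partial i u x + b *\<^sub>R partial i v x)"
proof
  fix x
  have "((\<lambda>x. a *\<^sub>R u x + b *\<^sub>R v x) has_derivative
      (\<lambda>w. a *\<^sub>R dirderiv w u x + b *\<^sub>R dirderiv w v x)) (at x)"
    by (intro derivative_intros smooth_has_derivative assms)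
  from dirderiv_eqI[OF this] 
  show "partial i (\<lambda>x. a *\<^sub>R u x + b *\<^sub>R v x) x = a *\<^sub>R partial i u x + b *\<^sub>R partial i v x"
    by (simp add: partial_def dirderiv_def)
qed

lemma partials_lincomb:
  assumes "smooth u" "smooth v"
  shows "partials is (\<lambda>x. a *\<^sub>R u x + b *\<^sub>R v x) = (\<lambda>x. a *\<^sub>R partials is u x + b *\<^sub>R partials is v x)"
  by (induction "is") (simp_all add: partial_lincomb smooth_partials assms)

lemma smooth_lincomb:
  assumes "smooth u" "smooth v"
  shows "smooth (\<lambda>x. a *\<^sub>R u x + b *\<^sub>R v x)"
  unfolding smooth_def partials_lincomb[OF assms]
  using assms unfolding smooth_def by (intro allI derivative_intros) auto

lemma partials_zero: "partials is (\<lambda>x. 0) = (\<lambda>x. 0)"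
  by (induction "is") (simp_all add: partial_def)

lemma schwartz_smooth: "schwartz u \<Longrightarrow> smooth u"
  by (simp add: schwartz_def)

lemma smooth_zero: "smooth (\<lambda>x. 0)"
  unfolding smooth_def partials_zero by auto

lemma schwartz_zero: "schwartz (\<lambda>x. 0)"
  unfolding schwartz_def partials_zero by (auto simp: smooth_zero)

lemma schwartz_lincomb:
  assumes "schwartz u" "schwartz v"
  shows "schwartz (\<lambda>x. a *\<^sub>R u x + b *\<^sub>R v x)"
  unfolding schwartz_def
proof (intro conjI allI)
  show "smooth (\<lambda>x. a *\<^sub>R u x + b *\<^sub>R v x)"
    using assms smooth_lincomb schwartz_smooth by blast
  fix N :: nat and "is" :: "'a list"
  obtain C where C: "\<And>x. norm x ^ N * norm (partials is u x) \<le> C"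
    using assms(1) unfolding schwartz_def by blast
  obtain D where D: "\<And>x. norm x ^ N * norm (partials is v x) \<le> D"
    using assms(2) unfolding schwartz_def by blast
  have "norm x ^ N * norm (a *\<^sub>R partials is u x + b *\<^sub>R partials is v x) \<le> \<bar>a\<bar> * C + \<bar>b\<bar> * D" for x
  proof -
    have "norm x ^ N * norm (a *\<^sub>R partials is u x + b *\<^sub>R partials is v x)
        \<le> norm x ^ N * (\<bar>a\<bar> * norm (partials is u x) + \<bar>b\<bar> * norm (partials is v x))"
      by (intro mult_left_mono order_trans[OF norm_triangle_ineq]) auto
    also have "\<dots> = \<bar>a\<bar> * (norm x ^ N * norm (partials is u x)) + \<bar>b\<bar> * (norm x ^ N * norm (partials is v x))"
      by (simp add: algebra_simps)
    also have "\<dots> \<le> \<bar>a\<bar> * C + \<bar>b\<bar> * D"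
      by (intro add_mono mult_left_mono C D) auto
    finally show ?thesis .
  qed
  then show "\<exists>C. \<forall>x. norm x ^ N * norm (partials is (\<lambda>x. a *\<^sub>R u x + b *\<^sub>R v x) x) \<le> C"
    unfolding partials_lincomb[OF assms[THEN schwartz_smooth]] by blast
qed

lemma schwartz_scaleR: "schwartz u \<Longrightarrow> schwartz (\<lambda>x. a *\<^sub>R u x)"
  using schwartz_lincomb[OF _ schwartz_zero, of u a 0] by simp

lemma schwartz_diff: "schwartz u \<Longrightarrow> schwartz v \<Longrightarrow> schwartz (\<lambda>x. u x - v x)"
  using schwartz_lincomb[of u v 1 "-1"] by simp

lemma schwartz_sum: "(\<And>i. i \<in> A \<Longrightarrow> schwartz (u i)) \<Longrightarrow> schwartz (\<lambda>x. \<Sum>i\<in>A. u i x)"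
proof (induction A rule: infinite_finite_induct)
  case (insert a A)
  then show ?case using schwartz_lincomb[of "u a" "\<lambda>x. \<Sum>i\<in>A. u i x" 1 1] by simp
qed (simp_all add: schwartz_zero)

lemma smooth_dirderiv:
  assumes "smooth u"
  shows "smooth (dirderiv v u)"
proof -
  have "smooth (\<lambda>x. \<Sum>i\<in>A. v $ i *\<^sub>R partial i u x)" for A
  proof (induction A rule: infinite_finite_induct)
    case (insert i A)
    then show ?case
      using smooth_lincomb[OF smooth_partial[OF assms, of i] insert.IH, of "v $ i" 1] by simp
  qed (simp_all add: smooth_zero)
  then show ?thesis
    using dirderiv_eq_sum_partial[OF assms] by presburger
qed

lemma schwartz_partial:
  assumes "schwartz u"
  shows "schwartz (partial i u)"
proof -
  have "partials is (partial i u) = partials (is @ [i]) u" for "is"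
    by (simp add: partials_append)
  then show ?thesis
    using assms unfolding schwartz_def by (auto intro: smooth_partial)
qed

lemma schwartz_dirderiv:
  assumes "schwartz u"
  shows "schwartz (dirderiv v u)"
proof -
  have "dirderiv v u = (\<lambda>x. \<Sum>i\<in>UNIV. v $ i *\<^sub>R partial i u x)"
    using dirderiv_eq_sum_partial[OF schwartz_smooth[OF assms]] by blast
  then show ?thesis
    by (simp add: schwartz_sum schwartz_scaleR schwartz_partial assms)
qed

lemma dirderiv_lincomb:
  assumes "smooth u" "smooth v"
  shows "dirderiv w (\<lambda>x. a *\<^sub>R u x + b *\<^sub>R v x) x = a *\<^sub>R dirderiv w u x + b *\<^sub>R dirderiv w v x"
proof (rule dirderiv_eqI)
  show "((\<lambda>x. a *\<^sub>R u x + b *\<^sub>R v x) has_derivative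
      (\<lambda>w. a *\<^sub>R dirderiv w u x + b *\<^sub>R dirderiv w v x)) (at x)"
    by (intro derivative_intros smooth_has_derivative assms)
qed

lemma dirderiv_sum:
  assumes "\<And>i. i \<in> A \<Longrightarrow> smooth (u i)"
  shows "dirderiv w (\<lambda>x. \<Sum>i\<in>A. c i *\<^sub>R u i x) x = (\<Sum>i\<in>A. c i *\<^sub>R dirderiv w (u i) x)"
proof (rule dirderiv_eqI)
  show "((\<lambda>x. \<Sum>i\<in>A. c i *\<^sub>R u i x) has_derivative
      (\<lambda>w. \<Sum>i\<in>A. c i *\<^sub>R dirderiv w (u i) x)) (at x)"
    by (intro derivative_intros smooth_has_derivative assms)
qed

lemma smooth_continuous: "smooth u \<Longrightarrow> continuous_on A u"
  by (meson continuous_at_imp_continuous_on differentiable_imp_continuous_within smooth_differentiable)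

lemma schwartz_continuous: "schwartz u \<Longrightarrow> continuous_on A u"
  by (rule smooth_continuous[OF schwartz_smooth])

lemma smooth_has_vector_derivative_along:
  assumes "smooth u" and "(g has_vector_derivative v) (at t)"
  shows "((\<lambda>t. u (g t)) has_vector_derivative dirderiv v u (g t)) (at t)"
proof -
  have "((u \<circ> g) has_derivative ((\<lambda>v. dirderiv v u (g t)) \<circ> (\<lambda>h. h *\<^sub>R v))) (at t)"
    by (rule diff_chain_at)
      (use assms smooth_has_derivative in \<open>auto simp: has_vector_derivative_def\<close>)
  then show ?thesis
    using dirderiv_scaleR_direction[OF assms(1)]
    by (simp add: has_vector_derivative_def o_def)
qed

text \<open>
  For second derivatives \<open>\<partial>\<^sub>w u(x + s v) - \<partial>\<^sub>w u(x)\<close> is the integral of \<open>\<partial>\<^sub>w \<partial>\<^sub>v u\<close> over the segment from \<open>x\<close> to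
  \<open>x + s v\<close>, by differentiating under the integral sign in the fundamental theorem of calculus.
  Differentiating this once more at \<open>s = 0\<close> exchanges the order.
\<close>

lemma dirderiv_commute:
  fixes u :: "real ^ 'n::finite \<Rightarrow> 'a::euclidean_space"
  assumes u: "smooth u"
  shows "dirderiv v (dirderiv w u) x = dirderiv w (dirderiv v u) x"
proof -
  note S = smooth_dirderiv
  define y where "y = (\<lambda>\<sigma> t. x + \<sigma> *\<^sub>R v + t *\<^sub>R w)"
  have ds: "((\<lambda>\<sigma>. h (y \<sigma> t)) has_vector_derivative dirderiv v h (y \<sigma> t)) (at \<sigma>)" if "smooth h" for h :: "real ^ 'n \<Rightarrow> 'a" and \<sigma> t
    unfolding y_def by (rule smooth_has_vector_derivative_along[OF that]) (auto intro!: derivative_eq_intros)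
  have dt: "((\<lambda>t. h (y \<sigma> t)) has_vector_derivative dirderiv w h (y \<sigma> t)) (at t)" if "smooth h" for h :: "real ^ 'n \<Rightarrow> 'a" and \<sigma> t
    unfolding y_def by (rule smooth_has_vector_derivative_along[OF that]) (auto intro!: derivative_eq_intros)
  have cont: "continuous_on A (\<lambda>(t, \<sigma>). h (y \<sigma> t))" if "smooth h" for h :: "real ^ 'n \<Rightarrow> 'a" and A
    unfolding y_def case_prod_beta
    by (rule continuous_on_compose2[OF smooth_continuous[OF that, of UNIV]]) (auto intro!: continuous_intros)
  have cont1: "continuous_on A (\<lambda>\<sigma>. h (y \<sigma> t))" if "smooth h" for h :: "real ^ 'n \<Rightarrow> 'a" and A t
    unfolding y_def
    by (rule continuous_on_compose2[OF smooth_continuous[OF that, of UNIV]]) (auto intro!: continuous_intros)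
  have ftc: "integral {0..s} (\<lambda>\<sigma>. dirderiv v h (y \<sigma> t)) = h (y s t) - h (y 0 t)"
    if "smooth h" "s \<ge> 0" for h :: "real ^ 'n \<Rightarrow> 'a" and s t
    by (intro integral_unique fundamental_theorem_of_calculus)
      (use that ds has_vector_derivative_at_within in blast)+
  have key: "dirderiv w u (y s 0) - dirderiv w u (y 0 0) = integral {0..s} (\<lambda>\<sigma>. dirderiv w (dirderiv v u) (y \<sigma> 0))" if "s \<ge> 0" for s
  proof -
    have "((\<lambda>t. integral (cbox 0 s) (\<lambda>\<sigma>. dirderiv v u (y \<sigma> t))) has_vector_derivative
        integral (cbox 0 s) (\<lambda>\<sigma>. dirderiv w (dirderiv v u) (y \<sigma> 0))) (at 0 within UNIV)"
      by (rule leibniz_rule_vector_derivative)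
        (auto intro!: dt S u cont integrable_continuous_interval cont1)
    moreover have "((\<lambda>t. integral (cbox 0 s) (\<lambda>\<sigma>. dirderiv v u (y \<sigma> t))) has_vector_derivative
        (dirderiv w u (y s 0) - dirderiv w u (y 0 0))) (at 0)"
      using that by (simp add: ftc[OF u]) (intro derivative_intros dt u)
    ultimately show ?thesis by (metis vector_derivative_unique_at cbox_interval)
  qed
  have "((\<lambda>s. dirderiv w u (y 0 0) + integral {0..s} (\<lambda>\<sigma>. dirderiv w (dirderiv v u) (y \<sigma> 0))) has_vector_derivative
        dirderiv w (dirderiv v u) (y 0 0)) (at 0 within {0..1})"
    using integral_has_vector_derivative[of 0 1 "\<lambda>\<sigma>. dirderiv w (dirderiv v u) (y \<sigma> 0)" 0]
    by (auto intro!: derivative_eq_intros cont1 S u)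
  then have "((\<lambda>s. dirderiv w u (y s 0)) has_vector_derivative dirderiv w (dirderiv v u) (y 0 0)) (at 0 within {0..1})"
    by (rule has_vector_derivative_transform[rotated 2]) (auto simp flip: key)
  moreover have "((\<lambda>s. dirderiv w u (y s 0)) has_vector_derivative dirderiv v (dirderiv w u) (y 0 0)) (at 0 within {0..1})"
    by (rule has_vector_derivative_at_within[OF ds]) (intro S u)
  ultimately have "dirderiv v (dirderiv w u) (y 0 0) = dirderiv w (dirderiv v u) (y 0 0)"
    by (intro vector_derivative_unique_within[of 0 "{0..1}" "\<lambda>s. dirderiv w u (y s 0)"])
      (auto simp: trivial_limit_within islimpt_Icc)
  then show ?thesis by (simp add: y_def)
qed

section \<open>Contraction and plane curl of symmetric tensor fields\<close>

text \<open>
  These fields contain components of every rank at the same time, so contraction and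
  differentiation are operations on one space and no rank has to be carried along. Invariance under
  permutations of the index list is expressed by comparing multisets.
\<close>

definition symmetric_schwartz :: "('n::finite, 'a::euclidean_space) tensor_field set" where
  "symmetric_schwartz = {f. (\<forall>is js. mset is = mset js \<longrightarrow> f is = f js) \<and> (\<forall>is. schwartz (f is))}"

definition contract :: "real ^ 'n::finite \<Rightarrow> ('n, 'a::euclidean_space) tensor_field \<Rightarrow> ('n, 'a) tensor_field" where
  "contract v f = (\<lambda>is x. \<Sum>a\<in>UNIV. v $ a *\<^sub>R f (a # is) x)"

definition tensor_dirderiv ::
    "real ^ 'n::finite \<Rightarrow> ('n, 'a::euclidean_space) tensor_field \<Rightarrow> ('n, 'a) tensor_field" where
  "tensor_dirderiv v f = (\<lambda>is. dirderiv v (f is))"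

text \<open>
  If \<open>f\<close> is a covector field, this is the curl of its restriction to a plane with direction
  vectors \<open>\<eta>\<close> and \<open>\<xi>\<close>, up to sign.
\<close>

definition plane_curl ::
    "real ^ 'n::finite \<Rightarrow> real ^ 'n \<Rightarrow> ('n, 'a::euclidean_space) tensor_field \<Rightarrow> ('n, 'a) tensor_field" where
  "plane_curl \<eta> \<xi> f =
     (\<lambda>is x. tensor_dirderiv \<xi> (contract \<eta> f) is x - tensor_dirderiv \<eta> (contract \<xi> f) is x)"

lemma symmetric_schwartzD:
  assumes "f \<in> symmetric_schwartz"
  shows "mset is = mset js \<Longrightarrow> f is = f js" "schwartz (f is)"
  using assms unfolding symmetric_schwartz_def by blast+

lemma symmetric_schwartzI:
  "\<lbrakk>\<And>is js. mset is = mset js \<Longrightarrow> f is = f js; \<And>is. schwartz (f is)\<rbrakk> \<Longrightarrow> f \<in> symmetric_schwartz"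
  unfolding symmetric_schwartz_def by blast

lemma contract_closed:
  assumes "f \<in> symmetric_schwartz"
  shows "contract v f \<in> symmetric_schwartz"
proof (rule symmetric_schwartzI)
  fix "is" js :: "'a list"
  assume "mset is = mset js"
  then have "f (a # is) = f (a # js)" for a
    by (intro symmetric_schwartzD(1)[OF assms]) simp
  then show "contract v f is = contract v f js"
    by (simp add: contract_def)
next
  show "schwartz (contract v f is)" for "is"
    unfolding contract_def by (intro schwartz_sum schwartz_scaleR symmetric_schwartzD(2)[OF assms])
qed

lemma tensor_dirderiv_closed:
  assumes "f \<in> symmetric_schwartz"
  shows "tensor_dirderiv v f \<in> symmetric_schwartz"
  unfolding tensor_dirderiv_def
  by (rule symmetric_schwartzI) (metis symmetric_schwartzD(1)[OF assms], intro schwartz_dirderiv symmetric_schwartzD(2)[OF assms])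

lemma diff_closed:
  assumes "f \<in> symmetric_schwartz" "g \<in> symmetric_schwartz"
  shows "(\<lambda>is x. f is x - g is x) \<in> symmetric_schwartz"
  by (rule symmetric_schwartzI)
    (metis assms symmetric_schwartzD(1), intro schwartz_diff symmetric_schwartzD(2) assms)

lemma plane_curl_closed:
  "f \<in> symmetric_schwartz \<Longrightarrow> plane_curl \<eta> \<xi> f \<in> symmetric_schwartz"
  unfolding plane_curl_def by (intro diff_closed tensor_dirderiv_closed contract_closed)

lemma contract_commute:
  assumes "f \<in> symmetric_schwartz"
  shows "contract v (contract w f) = contract w (contract v f)"
proof (intro ext)
  fix "is" x
  have "f (a # b # is) = f (b # a # is)" for a b
    by (rule symmetric_schwartzD(1)[OF assms]) simp
  then show "contract v (contract w f) is x = contract w (contract v f) is x"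
    unfolding contract_def scaleR_sum_right
    by (subst sum.swap) (simp add: mult.commute)
qed

lemma tensor_dirderiv_commute:
  "f \<in> symmetric_schwartz \<Longrightarrow>
    tensor_dirderiv v (tensor_dirderiv w f) = tensor_dirderiv w (tensor_dirderiv v f)"
  unfolding tensor_dirderiv_def by (intro ext dirderiv_commute schwartz_smooth symmetric_schwartzD(2))

lemma tensor_dirderiv_contract:
  assumes "f \<in> symmetric_schwartz"
  shows "tensor_dirderiv v (contract w f) = contract w (tensor_dirderiv v f)"
  unfolding tensor_dirderiv_def contract_def
  by (intro ext dirderiv_sum schwartz_smooth symmetric_schwartzD(2)[OF assms])

lemma contract_diff:
  "contract v (\<lambda>is x. f is x - g is x) = (\<lambda>is x. contract v f is x - contract v g is x)"
  unfolding contract_def by (simp add: scaleR_diff_right sum_subtractf)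

lemma tensor_dirderiv_diff:
  assumes "f \<in> symmetric_schwartz" "g \<in> symmetric_schwartz"
  shows "tensor_dirderiv v (\<lambda>is x. f is x - g is x) =
    (\<lambda>is x. tensor_dirderiv v f is x - tensor_dirderiv v g is x)"
proof (intro ext)
  fix "is" x
  have "smooth (f is)" "smooth (g is)"
    using assms by (auto intro: schwartz_smooth symmetric_schwartzD(2))
  from dirderiv_lincomb[OF this, of v 1 "-1" x]
  show "tensor_dirderiv v (\<lambda>is x. f is x - g is x) is x = tensor_dirderiv v f is x - tensor_dirderiv v g is x"
    by (simp add: tensor_dirderiv_def)
qed

lemma contract_shear: "contract (v + c *\<^sub>R w) f is x = contract v f is x + c *\<^sub>R contract w f is x"
  unfolding contract_def by (simp add: scaleR_add_left sum.distrib scaleR_sum_right)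

text \<open>
  The two additional terms \<open>c \<partial>\<^sub>\<eta> f(\<eta>, \<dots>)\<close> cancel. This invariance lets one operator serve a
  whole pencil of directions \<open>\<xi> + c \<eta>\<close>.
\<close>

lemma plane_curl_shear:
  assumes f: "f \<in> symmetric_schwartz"
  shows "plane_curl \<eta> (\<xi> + c *\<^sub>R \<eta>) f = plane_curl \<eta> \<xi> f"
proof (intro ext)
  fix "is" x
  have S: "smooth (contract v f is)" for v
    using f by (intro schwartz_smooth symmetric_schwartzD(2) contract_closed)
  have "dirderiv \<eta> (contract (\<xi> + c *\<^sub>R \<eta>) f is) x =
      dirderiv \<eta> (contract \<xi> f is) x + c *\<^sub>R dirderiv \<eta> (contract \<eta> f is) x"
    using dirderiv_lincomb[OF S S, of \<eta> 1 \<xi> c \<eta> x] by (simp add: contract_shear[abs_def])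
  then show "plane_curl \<eta> (\<xi> + c *\<^sub>R \<eta>) f is x = plane_curl \<eta> \<xi> f is x"
    by (simp add: plane_curl_def tensor_dirderiv_def dirderiv_add_direction dirderiv_scaleR_direction S)
qed

lemma contract_plane_curl:
  assumes "f \<in> symmetric_schwartz"
  shows "contract v (plane_curl \<eta> \<xi> f) = plane_curl \<eta> \<xi> (contract v f)"
  unfolding plane_curl_def contract_diff
  by (simp add: tensor_dirderiv_contract[symmetric] contract_commute[of f v] contract_closed assms)

lemma funpow_closed:
  "\<lbrakk>\<And>f. f \<in> S \<Longrightarrow> F f \<in> S; f \<in> S\<rbrakk> \<Longrightarrow> (F ^^ j) f \<in> S"
  by (induction j) auto

text \<open>
  The operators on tensor fields commute only on \<open>symmetric_schwartz\<close>, which is why commutation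
  of powers is needed relative to an invariant set.
\<close>

lemma funpow_commute_on:
  assumes "\<And>f. f \<in> S \<Longrightarrow> F f \<in> S" "\<And>f. f \<in> S \<Longrightarrow> G f \<in> S"
    and "\<And>f. f \<in> S \<Longrightarrow> F (G f) = G (F f)" and "f \<in> S"
  shows "(F ^^ i) ((G ^^ j) f) = (G ^^ j) ((F ^^ i) f)"
proof -
  have 1: "F ((G ^^ j) g) = (G ^^ j) (F g)" if "g \<in> S" for g j
    using that by (induction j) (simp_all add: assms funpow_closed[of S G])
  show ?thesis
    by (induction i) (simp_all add: 1 assms funpow_closed[of S F])
qed

lemma sum_lists_Suc:
  "(\<Sum>is | length is = Suc N. F is) = (\<Sum>a\<in>(UNIV::'n::finite set). \<Sum>is | length is = N. F (a # is))"
proof -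
  have "(\<Sum>is | length is = Suc N. F is) = (\<Sum>(a, is)\<in>UNIV \<times> {is. length is = N}. F (a # is))"
    by (rule sum.reindex_bij_witness[of _ "\<lambda>(a, is). a # is" "\<lambda>is. (hd is, tl is)"])
      (auto simp: length_Suc_conv)
  then show ?thesis by (simp add: sum.cartesian_product)
qed

lemma sum_lists_add:
  "(\<Sum>is | length is = M + N. F is) =
    (\<Sum>as | length as = M. \<Sum>bs | length bs = N. F (as @ bs))" for F :: "'n::finite list \<Rightarrow> 'a::comm_monoid_add"
  by (induction M arbitrary: F) (simp_all add: sum_lists_Suc)

definition weight :: "real ^ 'n \<Rightarrow> 'n list \<Rightarrow> real" where
  "weight v is = prod_list (map (\<lambda>i. v $ i) is)"

lemma weight_simps [simp]:
  "weight v [] = 1" "weight v (a # is) = v $ a * weight v is"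
  "weight v (is @ js) = weight v is * weight v js"
  by (simp_all add: weight_def)

lemma contract_power:
  "(contract v ^^ N) f js x = (\<Sum>is | length is = N. weight v is *\<^sub>R f (is @ js) x)"
proof (induction N arbitrary: f)
  case (Suc N)
  have "(contract v ^^ Suc N) f js x = (contract v ^^ N) (contract v f) js x"
    by (simp only: funpow_Suc_right o_apply)
  also have "\<dots> = (\<Sum>is | length is = N. \<Sum>a\<in>UNIV. weight v (a # is) *\<^sub>R f ((a # is) @ js) x)"
    unfolding Suc.IH by (simp add: contract_def scaleR_sum_right mult.commute)
  also have "\<dots> = (\<Sum>is | length is = Suc N. weight v is *\<^sub>R f (is @ js) x)"
    unfolding sum_lists_Suc by (rule sum.swap)
  finally show ?case .
qed simp

lemma tensor_dirderiv_power:
  assumes "f \<in> symmetric_schwartz"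
  shows "(tensor_dirderiv v ^^ N) f js x = (\<Sum>is | length is = N. weight v is *\<^sub>R partials is (f js) x)"
proof -
  have S: "smooth (partials is (f js))" for "is"
    by (intro smooth_partials schwartz_smooth symmetric_schwartzD(2) assms)
  have "(tensor_dirderiv v ^^ N) f js = (\<lambda>x. \<Sum>is | length is = N. weight v is *\<^sub>R partials is (f js) x)"
  proof (induction N)
    case (Suc N)
    have "(tensor_dirderiv v ^^ Suc N) f js = dirderiv v ((tensor_dirderiv v ^^ N) f js)"
      by (simp add: tensor_dirderiv_def)
    also have "\<dots> = (\<lambda>x. \<Sum>is | length is = N. \<Sum>a\<in>UNIV. weight v (a # is) *\<^sub>R partials (a # is) (f js) x)"
      unfolding Suc
      by (simp add: fun_eq_iff dirderiv_sum S dirderiv_eq_sum_partial scaleR_sum_right mult.commute)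
    also have "\<dots> = (\<lambda>x. \<Sum>is | length is = Suc N. weight v is *\<^sub>R partials is (f js) x)"
      unfolding sum_lists_Suc by (subst sum.swap) (rule refl)
    finally show ?case .
  qed simp
  then show ?thesis by simp
qed

section \<open>Moments along lines\<close>

lemma integrable_const_over_1_plus_square: "integrable lborel (\<lambda>t::real. C / (1 + t\<^sup>2))"
proof -
  have "integrable lborel (\<lambda>t::real. C * inverse (1 + t\<^sup>2))"
    using integrable_inverse_1_plus_square by (intro integrable_mult_right) (simp add: set_integrable_def)
  then show ?thesis by (simp add: divide_inverse)
qed

text \<open>
  Dominated convergence of the difference quotients, whose distance from the derivative is at
  most \<open>2 B\<close> by the mean value inequality.
\<close>

lemma has_vector_derivative_integral:
  fixes F F' :: "real \<Rightarrow> real \<Rightarrow> 'a::euclidean_space"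
  assumes \<delta>: "\<delta> > 0"
    and deriv: "\<And>c t. \<bar>c\<bar> < \<delta> \<Longrightarrow> ((\<lambda>c. F c t) has_vector_derivative F' c t) (at c)"
    and int: "\<And>c. \<bar>c\<bar> < \<delta> \<Longrightarrow> integrable M (F c)" "integrable M (F' 0)"
    and bound: "\<And>c t. \<bar>c\<bar> < \<delta> \<Longrightarrow> norm (F' c t) \<le> B t" and B: "integrable M B"
  shows "((\<lambda>c. integral\<^sup>L M (F c)) has_vector_derivative integral\<^sup>L M (F' 0)) (at 0)"
  unfolding has_vector_derivative_def has_derivative_iff_norm
proof (intro conjI)
  show "bounded_linear (\<lambda>x. x *\<^sub>R integral\<^sup>L M (F' 0))"
    by (rule bounded_linear_scaleR_left)
  \<comment> \<open>The error of the difference quotient.\<close>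
  define Q where "Q c t = (1 / \<bar>c\<bar>) *\<^sub>R (F c t - F 0 t - c *\<^sub>R F' 0 t)" for c t
  have Q_bound: "norm (Q c t) \<le> 2 * B t" if "\<bar>c\<bar> < \<delta>" "c \<noteq> 0" for c t
  proof -
    have "norm (F' x t - F' 0 t) \<le> 2 * B t" if "\<bar>x\<bar> < \<delta>" for x
      using norm_triangle_ineq4[of "F' x t" "F' 0 t"] bound[OF that, of t] bound[of 0 t] \<delta> by simp
    moreover have "closed_segment 0 c \<subseteq> {-\<delta><..<\<delta>}"
      using that \<delta> by (auto simp: closed_segment_eq_real_ivl)
    ultimately have "norm (F c t - F 0 t - (c - 0) *\<^sub>R F' 0 t) \<le> norm (c - 0) * (2 * B t)"
      by (intro vector_differentiable_bound_linearization[where S = "{-\<delta><..<\<delta>}" and f' = "\<lambda>c. F' c t"])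
        (use \<delta> in \<open>auto simp: abs_less_iff intro!: has_vector_derivative_at_within[OF deriv]\<close>)
    moreover have "norm (Q c t) = norm (F c t - F 0 t - (c - 0) *\<^sub>R F' 0 t) / \<bar>c\<bar>"
      by (simp add: Q_def)
    ultimately show ?thesis
      using that by (simp add: pos_divide_le_eq mult.commute)
  qed
  have Q_lim: "((\<lambda>c. Q c t) \<longlongrightarrow> 0) (at 0)" for t
  proof (rule tendsto_norm_zero_cancel)
    show "((\<lambda>c. norm (Q c t)) \<longlongrightarrow> 0) (at 0)"
      using deriv[of 0 t] \<delta>
      unfolding has_vector_derivative_def has_derivative_iff_norm by (simp add: Q_def)
  qed
  have "((\<lambda>c. integral\<^sup>L M (Q c)) \<longlongrightarrow> 0) (at 0)"
    unfolding tendsto_at_iff_sequentially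
  proof (intro allI impI)
    fix X :: "nat \<Rightarrow> real"
    assume X: "\<forall>i. X i \<in> UNIV - {0}" "X \<longlonglongrightarrow> 0"
    obtain i0 where i0: "\<bar>X i\<bar> < \<delta>" if "i \<ge> i0" for i
      using LIMSEQ_D[OF X(2) \<delta>] by auto
    have "(\<lambda>i. integral\<^sup>L M (Q (X (i + i0)))) \<longlonglongrightarrow> integral\<^sup>L M (\<lambda>t. 0)"
    proof (rule integral_dominated_convergence[where w = "\<lambda>t. 2 * B t"])
      show "Q (X (i + i0)) \<in> borel_measurable M" for i
        unfolding Q_def using int i0[of "i + i0"] \<delta> 
        by (intro borel_measurable_scaleR borel_measurable_diff borel_measurable_const borel_measurable_integrable) auto
      have "(\<lambda>i. X (i + i0)) \<longlonglongrightarrow> 0" using X(2) by (rule LIMSEQ_ignore_initial_segment)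
      moreover have "\<forall>i. X (i + i0) \<noteq> 0" using X(1) by simp
      ultimately show "AE t in M. (\<lambda>i. Q (X (i + i0)) t) \<longlonglongrightarrow> 0"
        using Q_lim unfolding tendsto_at_iff_sequentially by (auto simp: o_def)
      show "AE t in M. norm (Q (X (i + i0)) t) \<le> 2 * B t" for i
        using Q_bound i0[of "i + i0"] X(1) by auto
    qed (use B in auto)
    then show "((\<lambda>c. integral\<^sup>L M (Q c)) \<circ> X) \<longlonglongrightarrow> 0"
      by (simp add: o_def LIMSEQ_offset)
  qed
  then have "((\<lambda>c. norm (integral\<^sup>L M (Q c))) \<longlongrightarrow> 0) (at 0)"
    by (rule tendsto_norm_zero)
  moreover have "\<forall>\<^sub>F c in at 0. norm (integral\<^sup>L M (Q c)) =
     norm (integral\<^sup>L M (F c) - integral\<^sup>L M (F 0) - (c - 0) *\<^sub>R integral\<^sup>L M (F' 0)) / norm (c - 0)"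
  proof -
    have "\<forall>\<^sub>F c in at (0::real). \<bar>c\<bar> < \<delta>"
      using \<delta> by (auto simp: eventually_at dist_real_def)
    then show ?thesis
    proof eventually_elim
      case (elim c)
      have "integral\<^sup>L M (Q c) = (1 / \<bar>c\<bar>) *\<^sub>R (integral\<^sup>L M (F c) - integral\<^sup>L M (F 0) - c *\<^sub>R integral\<^sup>L M (F' 0))"
        unfolding Q_def using int elim \<delta> by simp
      then show ?case by simp
    qed
  qed
  ultimately show "((\<lambda>c. norm (integral\<^sup>L M (F c) - integral\<^sup>L M (F 0) - (c - 0) *\<^sub>R integral\<^sup>L M (F' 0)) / norm (c - 0)) \<longlongrightarrow> 0) (at 0)"
    by (rule Lim_transform_eventually)
qed

lemma schwartz_decay:
  assumes "schwartz u"
  shows "\<exists>C. \<forall>y. (1 + norm y) ^ N * norm (u y) \<le> C"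
proof -
  obtain C where C: "\<And>y. norm y ^ N * norm (u y) \<le> C"
    using assms unfolding schwartz_def by (metis partials.simps(1))
  obtain D where D: "\<And>y. norm y ^ 0 * norm (u y) \<le> D"
    using assms unfolding schwartz_def by (metis partials.simps(1))
  have "(1 + norm y) ^ N * norm (u y) \<le> 2 ^ N * (C + D)" for y
  proof -
    have "1 + norm y \<le> 2 * max 1 (norm y)" by auto
    then have "(1 + norm y) ^ N \<le> (2 * max 1 (norm y)) ^ N" by (intro power_mono) auto
    also have "\<dots> \<le> 2 ^ N * (1 + norm y ^ N)"
      by (auto simp: power_mult_distrib max_def)
    finally have "(1 + norm y) ^ N * norm (u y) \<le> 2 ^ N * (1 + norm y ^ N) * norm (u y)"
      by (intro mult_right_mono) auto
    also have "\<dots> = 2 ^ N * (norm y ^ N * norm (u y) + norm y ^ 0 * norm (u y))"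
      by (simp add: algebra_simps)
    also have "\<dots> \<le> 2 ^ N * (C + D)"
      by (intro mult_left_mono add_mono C D) auto
    finally show ?thesis .
  qed
  then show ?thesis by blast
qed

text \<open>
  The hypotheses on \<open>s\<close> and \<open>t\<close> say that they grow at most like \<open>y\<close>, as coordinates in a plane do.
  With all constants independent of \<open>y\<close>, the bound dominates integrals over lines uniformly in the
  line, gives decay transversally to the line, and gives integrability over planes.
\<close>

lemma schwartz_plane_decay:
  assumes "schwartz u"
  shows "\<exists>C. \<forall>y s t. \<bar>s\<bar> \<le> A * (1 + norm y) \<longrightarrow> \<bar>t\<bar> \<le> A * (1 + norm y) \<longrightarrow>
    \<bar>t\<bar> ^ q * norm (u y) \<le> C / ((1 + s\<^sup>2) * (1 + t\<^sup>2))"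
proof -
  \<comment> \<open>Two powers for each of the two denominators and \<open>q\<close> for the power of \<open>t\<close>.\<close>
  obtain C where C: "\<And>y. (1 + norm y) ^ (4 + q) * norm (u y) \<le> C"
    using schwartz_decay[OF assms] by blast
  have "\<bar>t\<bar> ^ q * norm (u y) \<le> (1 + A\<^sup>2)\<^sup>2 * A ^ q * C / ((1 + s\<^sup>2) * (1 + t\<^sup>2))"
    if s: "\<bar>s\<bar> \<le> A * (1 + norm y)" and t: "\<bar>t\<bar> \<le> A * (1 + norm y)" for y s t
  proof -
    define r where "r = 1 + norm y"
    have r: "r \<ge> 1" by (simp add: r_def)
    have A: "A \<ge> 0" using s r unfolding r_def by (smt (verit) mult_nonneg_nonneg mult_neg_pos)
    have sq: "1 + a\<^sup>2 \<le> (1 + A\<^sup>2) * r\<^sup>2" if "\<bar>a\<bar> \<le> A * r" for a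
    proof -
      have "a\<^sup>2 \<le> (A * r)\<^sup>2" using that A r by (simp add: abs_le_square_iff[symmetric])
      moreover have "1 \<le> r\<^sup>2" using r by simp
      ultimately show ?thesis by (simp add: algebra_simps power_mult_distrib)
    qed
    have "(1 + s\<^sup>2) * (1 + t\<^sup>2) * (\<bar>t\<bar> ^ q) \<le> ((1 + A\<^sup>2) * r\<^sup>2) * ((1 + A\<^sup>2) * r\<^sup>2) * (A * r) ^ q"
      using s t A r by (intro mult_mono sq power_mono) (auto simp: r_def)
    also have "\<dots> = (1 + A\<^sup>2)\<^sup>2 * A ^ q * r ^ (4 + q)"
      by (simp add: power_mult_distrib power2_eq_square power_add eval_nat_numeral)
    finally have "(1 + s\<^sup>2) * (1 + t\<^sup>2) * (\<bar>t\<bar> ^ q) * norm (u y) \<le> (1 + A\<^sup>2)\<^sup>2 * A ^ q * r ^ (4 + q) * norm (u y)"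
      by (rule mult_right_mono) simp
    also have "\<dots> = (1 + A\<^sup>2)\<^sup>2 * A ^ q * (r ^ (4 + q) * norm (u y))" by simp
    also have "\<dots> \<le> (1 + A\<^sup>2)\<^sup>2 * A ^ q * C"
      using C[of y] A by (intro mult_left_mono) (auto simp: r_def)
    finally have "(1 + s\<^sup>2) * (1 + t\<^sup>2) * (\<bar>t\<bar> ^ q) * norm (u y) \<le> (1 + A\<^sup>2)\<^sup>2 * A ^ q * C" .
    moreover have "0 < (1 + s\<^sup>2) * (1 + t\<^sup>2)" by (simp add: add_pos_nonneg)
    ultimately show ?thesis by (simp add: pos_le_divide_eq mult.commute mult.left_commute)
  qed
  then show ?thesis by blast
qed

lemma schwartz_line_decay:
  assumes "schwartz u"
  shows "\<exists>C. \<forall>y t. \<bar>t\<bar> \<le> A * (1 + norm y) \<longrightarrow> \<bar>t\<bar> ^ q * norm (u y) \<le> C / (1 + t\<^sup>2)"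
proof -
  obtain C where C: "\<And>y s t. \<lbrakk>\<bar>s\<bar> \<le> A * (1 + norm y); \<bar>t\<bar> \<le> A * (1 + norm y)\<rbrakk> \<Longrightarrow>
    \<bar>t\<bar> ^ q * norm (u y) \<le> C / ((1 + s\<^sup>2) * (1 + t\<^sup>2))"
    using schwartz_plane_decay[OF assms, of A q] by blast
  have "\<bar>t\<bar> ^ q * norm (u y) \<le> C / (1 + t\<^sup>2)" if "\<bar>t\<bar> \<le> A * (1 + norm y)" for y t
    using C[of 0 y t] that by auto
  then show ?thesis by blast
qed

definition line_moment :: "nat \<Rightarrow> (real ^ 'n::finite \<Rightarrow> 'a::euclidean_space) \<Rightarrow> real ^ 'n \<Rightarrow> real ^ 'n \<Rightarrow> 'a" where
  "line_moment q u x \<theta> = (\<integral>t. t ^ q *\<^sub>R u (x + t *\<^sub>R \<theta>) \<partial>lborel)"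

lemma line_parameter_bound:
  fixes x \<theta> :: "'b::real_normed_vector"
  assumes "r > 0" "norm \<theta> \<ge> r" "norm x \<le> R"
  shows "\<bar>t\<bar> \<le> (1 + R) / r * (1 + norm (x + t *\<^sub>R \<theta>))"
proof -
  have "\<bar>t\<bar> * r \<le> norm (t *\<^sub>R \<theta>)" using assms by (simp add: mult_left_mono)
  also have "\<dots> \<le> norm (x + t *\<^sub>R \<theta>) + norm x"
    by (metis add.commute add_diff_cancel_left' norm_triangle_ineq4)
  also have "\<dots> \<le> (1 + R) * (1 + norm (x + t *\<^sub>R \<theta>))"
    using assms(3) norm_ge_zero[of x]
    by (simp add: algebra_simps) (smt (verit) mult_nonneg_nonneg norm_ge_zero)
  finally show ?thesis using assms(1) by (simp add: field_simps)
qed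

lemma continuous_line:
  "schwartz u \<Longrightarrow> continuous_on A (\<lambda>t. u (x + t *\<^sub>R \<theta>))"
  by (rule continuous_on_compose2[OF schwartz_continuous[of u UNIV]]) (auto intro!: continuous_intros)

lemma line_moment_integrable:
  fixes u :: "real ^ 'n::finite \<Rightarrow> 'a::euclidean_space"
  assumes "schwartz u" "\<theta> \<noteq> 0"
  shows "integrable lborel (\<lambda>t. t ^ q *\<^sub>R u (x + t *\<^sub>R \<theta>))" (is "integrable _ ?F")
proof -
  obtain C where C: "\<And>y t. \<bar>t\<bar> \<le> (1 + norm x) / norm \<theta> * (1 + norm y) \<Longrightarrow> \<bar>t\<bar> ^ q * norm (u y) \<le> C / (1 + t\<^sup>2)"
    using schwartz_line_decay[OF assms(1), of _ q] by blast
  have b: "norm (?F t) \<le> C / (1 + t\<^sup>2)" for t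
    using C[OF line_parameter_bound[of "norm \<theta>" \<theta> x]] assms(2) by (simp add: power_abs)
  show ?thesis
  proof (rule Bochner_Integration.integrable_bound[OF integrable_const_over_1_plus_square[of C]])
    show "?F \<in> borel_measurable lborel"
      by (simp, intro borel_measurable_continuous_onI continuous_intros continuous_line assms)
    show "AE t in lborel. norm (?F t) \<le> norm (C / (1 + t\<^sup>2))"
      using b by (intro AE_I2) (smt (verit) real_norm_def)
  qed
qed

lemma line_moment_diff:
  assumes "schwartz u" "schwartz v" "\<theta> \<noteq> 0"
  shows "line_moment q (\<lambda>x. u x - v x) x \<theta> = line_moment q u x \<theta> - line_moment q v x \<theta>"
  unfolding line_moment_def using assms
  by (simp add: scaleR_diff_right Bochner_Integration.integral_diff line_moment_integrable)

text \<open>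
  Translating the line by \<open>s \<eta>\<close> moves the base point of every evaluation of \<open>u\<close> in the same way;
  the decay of \<open>\<partial>\<^sub>\<eta> u\<close> along the lines is uniform for bounded \<open>s\<close>.
\<close>

lemma line_moment_transverse_derivative:
  assumes u: "schwartz u" and \<theta>: "\<theta> \<noteq> 0"
  shows "((\<lambda>s. line_moment q u (x + s *\<^sub>R \<eta>) \<theta>) has_vector_derivative line_moment q (dirderiv \<eta> u) (x + a *\<^sub>R \<eta>) \<theta>) (at a)"
proof -
  have 0: "((\<lambda>s. line_moment q u (x + s *\<^sub>R \<eta>) \<theta>) has_vector_derivative line_moment q (dirderiv \<eta> u) x \<theta>) (at 0)" for x
  proof -
    let ?R = "norm x + norm \<eta>"
    obtain C where C: "\<And>y t. \<bar>t\<bar> \<le> (1 + ?R) / norm \<theta> * (1 + norm y) \<Longrightarrow> \<bar>t\<bar> ^ q * norm (dirderiv \<eta> u y) \<le> C / (1 + t\<^sup>2)"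
      using schwartz_line_decay[OF schwartz_dirderiv[OF u], of _ q] by blast
    have d: "((\<lambda>c. t ^ q *\<^sub>R u (x + c *\<^sub>R \<eta> + t *\<^sub>R \<theta>)) has_vector_derivative
       t ^ q *\<^sub>R dirderiv \<eta> u (x + c *\<^sub>R \<eta> + t *\<^sub>R \<theta>)) (at c)" for c t
      by (rule bounded_linear.has_vector_derivative[OF bounded_linear_scaleR_right smooth_has_vector_derivative_along[OF schwartz_smooth[OF u]]])
        (auto intro!: derivative_eq_intros)
    have "((\<lambda>c. \<integral>t. t ^ q *\<^sub>R u (x + c *\<^sub>R \<eta> + t *\<^sub>R \<theta>) \<partial>lborel) has_vector_derivative
       (\<integral>t. t ^ q *\<^sub>R dirderiv \<eta> u (x + 0 *\<^sub>R \<eta> + t *\<^sub>R \<theta>) \<partial>lborel)) (at 0)"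
    proof (rule has_vector_derivative_integral[of 1 "\<lambda>c t. t ^ q *\<^sub>R u (x + c *\<^sub>R \<eta> + t *\<^sub>R \<theta>)" "\<lambda>c t. t ^ q *\<^sub>R dirderiv \<eta> u (x + c *\<^sub>R \<eta> + t *\<^sub>R \<theta>)"  lborel "\<lambda>t. C / (1 + t\<^sup>2)"])
      fix c t :: real
      assume c: "\<bar>c\<bar> < 1"
      have "norm (x + c *\<^sub>R \<eta>) \<le> ?R"
        using norm_triangle_ineq[of x "c *\<^sub>R \<eta>"] c mult_right_mono[of "\<bar>c\<bar>" 1 "norm \<eta>"] by simp
      from C[OF line_parameter_bound[OF _ order_refl this]]
      show "norm (t ^ q *\<^sub>R dirderiv \<eta> u (x + c *\<^sub>R \<eta> + t *\<^sub>R \<theta>)) \<le> C / (1 + t\<^sup>2)"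
        using \<theta> by (simp add: power_abs)
    qed (use \<theta> in \<open>auto intro!: d line_moment_integrable u schwartz_dirderiv integrable_const_over_1_plus_square\<close>)
    then show ?thesis by (simp add: line_moment_def)
  qed
  have "((\<lambda>s. line_moment q u (x + a *\<^sub>R \<eta> + (s - a) *\<^sub>R \<eta>) \<theta>) has_vector_derivative 1 *\<^sub>R line_moment q (dirderiv \<eta> u) (x + a *\<^sub>R \<eta>) \<theta>) (at a)"
    by (rule vector_diff_chain_at[where f = "\<lambda>s. s - a" and f' = 1, unfolded o_def])
      (auto intro!: derivative_eq_intros 0)
  then show ?thesis by (simp add: algebra_simps)
qed

text \<open>
  Integration by parts: along the line, \<open>\<partial>\<^sub>\<theta> u\<close> is the derivative with respect to the parameter.
  For \<open>q = 0\<close> the factor \<open>q\<close> is zero, and the truncated exponent \<open>q - 1\<close> does no harm.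
\<close>

lemma line_moment_longitudinal_derivative:
  assumes u: "schwartz u" and \<theta>: "\<theta> \<noteq> 0"
  shows "line_moment q (dirderiv \<theta> u) x \<theta> = - (real q *\<^sub>R line_moment (q - 1) u x \<theta>)"
proof -
  let ?F = "\<lambda>t. t ^ q *\<^sub>R u (x + t *\<^sub>R \<theta>)"
  let ?f = "\<lambda>t. t ^ q *\<^sub>R dirderiv \<theta> u (x + t *\<^sub>R \<theta>) + real q *\<^sub>R t ^ (q - 1) *\<^sub>R u (x + t *\<^sub>R \<theta>)"
  note S = u schwartz_dirderiv[OF u]
  obtain C where C: "\<And>y t. \<bar>t\<bar> \<le> (1 + norm x) / norm \<theta> * (1 + norm y) \<Longrightarrow> \<bar>t\<bar> ^ q * norm (u y) \<le> C / (1 + t\<^sup>2)"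
    using schwartz_line_decay[OF assms(1), of _ q] by blast
  have b: "norm (?F t) \<le> C / (1 + t\<^sup>2)" for t
    using C[OF line_parameter_bound[of "norm \<theta>" \<theta> x]] assms(2) by (simp add: power_abs)
  have int: "integrable lborel ?f"
    by (intro Bochner_Integration.integrable_add integrable_scaleR_right line_moment_integrable S \<theta>)
  have "continuous_on UNIV ?f"
    by (intro continuous_intros continuous_line S)
  then have cont: "isCont ?f t" for t by (simp add: continuous_on_eq_continuous_at)
  have lim: "(?F \<longlongrightarrow> 0) F" if "((\<lambda>t. C / (1 + t\<^sup>2)) \<longlongrightarrow> 0) F" for F
    by (rule Lim_null_comparison[OF always_eventually that]) (use b in blast)
  have "(LBINT t=-\<infinity>..\<infinity>. ?f t) = 0 - 0"
  proof (rule interval_integral_FTC_integrable[where F = ?F])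
    show "(?F has_vector_derivative ?f t) (at t)" for t
      by (rule has_vector_derivative_scaleR[THEN has_vector_derivative_eq_rhs])
        (auto intro!: derivative_eq_intros smooth_has_vector_derivative_along[OF schwartz_smooth[OF u]])
    show "((?F \<circ> real_of_ereal) \<longlongrightarrow> 0) (at_right (- \<infinity>))" unfolding ereal_tendsto_simps 
      by (intro lim tendsto_divide_0[OF tendsto_const] filterlim_at_top_imp_at_infinity
        filterlim_tendsto_add_at_top[OF tendsto_const] filterlim_pow_at_top filterlim_ident
        filterlim_pow_at_bot_even) auto
    show "((?F \<circ> real_of_ereal) \<longlongrightarrow> 0) (at_left \<infinity>)" unfolding ereal_tendsto_simps 
      by (intro lim tendsto_divide_0[OF tendsto_const] filterlim_at_top_imp_at_infinity
        filterlim_tendsto_add_at_top[OF tendsto_const] filterlim_pow_at_top filterlim_ident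
        filterlim_pow_at_bot_even) auto
  qed (use int cont in \<open>auto simp: set_integrable_def\<close>)
  then have "integral\<^sup>L lborel ?f = 0"
    by (simp add: interval_lebesgue_integral_def set_lebesgue_integral_def)
  moreover have "integral\<^sup>L lborel ?f = line_moment q (dirderiv \<theta> u) x \<theta> + real q *\<^sub>R line_moment (q - 1) u x \<theta>"
    unfolding line_moment_def
    using Bochner_Integration.integral_add[OF line_moment_integrable[OF S(2) \<theta>]
        integrable_scaleR_right[OF line_moment_integrable[OF S(1) \<theta>]]]
    by (simp del: scaleR_scaleR)
  ultimately show ?thesis by (simp add: eq_neg_iff_add_eq_0)
qed

section \<open>Moments along a pencil of directions\<close>

lemma contract_power_closed:
  "f \<in> symmetric_schwartz \<Longrightarrow> (contract v ^^ m) f \<in> symmetric_schwartz"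
  by (rule funpow_closed) (rule contract_closed)

lemma contract_power_commute:
  "f \<in> symmetric_schwartz \<Longrightarrow> contract w ((contract v ^^ m) f) = (contract v ^^ m) (contract w f)"
  using funpow_commute_on[of symmetric_schwartz "contract w" "contract v" f 1 m]
  by (simp add: contract_closed contract_commute)

lemma abs_weight_le: 
  assumes "norm v \<le> R" 
  shows "\<bar>weight v is\<bar> \<le> R ^ length is"
proof (induction "is")
  case (Cons a "is")
  have "\<bar>v $ a\<bar> \<le> R" using component_le_norm_cart[of v a] assms by linarith
  then show ?case using Cons by (auto simp: abs_mult intro: mult_mono)
qed simp

text \<open>
  Uniformity in the contracting vector is what differentiation with respect to the direction
  of a line requires.
\<close>

lemma contract_power_decay:
  assumes f: "f \<in> symmetric_schwartz"
  shows "\<exists>C. \<forall>v y t. norm v \<le> R \<longrightarrow> \<bar>t\<bar> \<le> A * (1 + norm y) \<longrightarrow>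
    \<bar>t\<bar> ^ q * norm ((contract v ^^ m) f js y) \<le> C / (1 + t\<^sup>2)"
proof -
  have "\<exists>C. \<forall>y t. \<bar>t\<bar> \<le> A * (1 + norm y) \<longrightarrow> \<bar>t\<bar> ^ q * norm (f (is @ js) y) \<le> C / (1 + t\<^sup>2)" for "is"
    by (intro schwartz_line_decay symmetric_schwartzD(2) f)
  then obtain C where C: "\<And>is y t. \<bar>t\<bar> \<le> A * (1 + norm y) \<Longrightarrow> \<bar>t\<bar> ^ q * norm (f (is @ js) y) \<le> C is / (1 + t\<^sup>2)"
    by metis
  have "\<bar>t\<bar> ^ q * norm ((contract v ^^ m) f js y) \<le> (\<Sum>is | length is = m. R ^ m * C is) / (1 + t\<^sup>2)"
    if v: "norm v \<le> R" and t: "\<bar>t\<bar> \<le> A * (1 + norm y)" for v y t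
  proof -
    have R: "R \<ge> 0" using v norm_ge_zero[of v] by linarith
    have "\<bar>t\<bar> ^ q * norm ((contract v ^^ m) f js y) \<le> \<bar>t\<bar> ^ q * (\<Sum>is | length is = m. norm (weight v is *\<^sub>R f (is @ js) y))"
      unfolding contract_power by (intro mult_left_mono norm_sum) auto
    also have "\<dots> = (\<Sum>is | length is = m. \<bar>weight v is\<bar> * (\<bar>t\<bar> ^ q * norm (f (is @ js) y)))"
      by (simp add: sum_distrib_left mult_ac)
    also have "\<dots> \<le> (\<Sum>is | length is = m. R ^ m * (C is / (1 + t\<^sup>2)))"
      using abs_weight_le[OF v] C[OF t] R by (intro sum_mono mult_mono) auto
    finally show ?thesis by (simp add: sum_divide_distrib)
  qed
  then show ?thesis by blast
qed

text \<open>
  Product rule: each of the \<open>m\<close> slots contributes the same amount because \<open>f\<close> is symmetric, and the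
  motion of the base point with velocity \<open>t \<eta>\<close> contributes the last term.
\<close>

lemma contract_power_pencil_derivative:
  assumes f: "f \<in> symmetric_schwartz"
  shows "((\<lambda>c. (contract (\<theta> + c *\<^sub>R \<eta>) ^^ m) f js (x + t *\<^sub>R (\<theta> + c *\<^sub>R \<eta>))) has_vector_derivative
     real m *\<^sub>R (contract (\<theta> + c *\<^sub>R \<eta>) ^^ (m - 1)) (contract \<eta> f) js (x + t *\<^sub>R (\<theta> + c *\<^sub>R \<eta>)) +
     t *\<^sub>R (contract (\<theta> + c *\<^sub>R \<eta>) ^^ m) (tensor_dirderiv \<eta> f) js (x + t *\<^sub>R (\<theta> + c *\<^sub>R \<eta>))) (at c)"
proof (induction m arbitrary: js)
  case 0
  have "((\<lambda>c. f js (x + t *\<^sub>R (\<theta> + c *\<^sub>R \<eta>))) has_vector_derivative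
      dirderiv (t *\<^sub>R \<eta>) (f js) (x + t *\<^sub>R (\<theta> + c *\<^sub>R \<eta>))) (at c)"
    by (rule smooth_has_vector_derivative_along[OF schwartz_smooth[OF symmetric_schwartzD(2)[OF f]]]) (auto intro!: derivative_eq_intros)
  then show ?case
    by (simp add: tensor_dirderiv_def dirderiv_scaleR_direction schwartz_smooth symmetric_schwartzD(2)[OF f])
next
  case (Suc m)
  let ?v = "\<theta> + c *\<^sub>R \<eta>"
  let ?y = "x + t *\<^sub>R ?v"
  let ?D = "\<lambda>js. real m *\<^sub>R (contract ?v ^^ (m - 1)) (contract \<eta> f) js ?y +
     t *\<^sub>R (contract ?v ^^ m) (tensor_dirderiv \<eta> f) js ?y"
  have comp: "((\<lambda>c. (\<theta> + c *\<^sub>R \<eta>) $ a) has_real_derivative \<eta> $ a) (at c)" for a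
    by (auto intro!: derivative_eq_intros)
  have "((\<lambda>c. \<Sum>a\<in>UNIV. (\<theta> + c *\<^sub>R \<eta>) $ a *\<^sub>R (contract (\<theta> + c *\<^sub>R \<eta>) ^^ m) f (a # js) (x + t *\<^sub>R (\<theta> + c *\<^sub>R \<eta>)))
     has_vector_derivative (\<Sum>a\<in>UNIV. ?v $ a *\<^sub>R ?D (a # js) + \<eta> $ a *\<^sub>R (contract ?v ^^ m) f (a # js) ?y)) (at c)"
    by (intro has_vector_derivative_sum has_vector_derivative_scaleR comp Suc.IH)
  also have "(\<lambda>c. \<Sum>a\<in>UNIV. (\<theta> + c *\<^sub>R \<eta>) $ a *\<^sub>R (contract (\<theta> + c *\<^sub>R \<eta>) ^^ m) f (a # js) (x + t *\<^sub>R (\<theta> + c *\<^sub>R \<eta>)))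
     = (\<lambda>c. (contract (\<theta> + c *\<^sub>R \<eta>) ^^ Suc m) f js (x + t *\<^sub>R (\<theta> + c *\<^sub>R \<eta>)))"
    by (simp add: contract_def)
  also have "(\<Sum>a\<in>UNIV. ?v $ a *\<^sub>R ?D (a # js) + \<eta> $ a *\<^sub>R (contract ?v ^^ m) f (a # js) ?y) =
     real m *\<^sub>R contract ?v ((contract ?v ^^ (m - 1)) (contract \<eta> f)) js ?y +
     t *\<^sub>R contract ?v ((contract ?v ^^ m) (tensor_dirderiv \<eta> f)) js ?y + contract \<eta> ((contract ?v ^^ m) f) js ?y"
    by (simp add: contract_def[of _ "(contract _ ^^ _) _"] sum.distrib scaleR_add_right scaleR_sum_right mult.commute)
  also have "real m *\<^sub>R contract ?v ((contract ?v ^^ (m - 1)) (contract \<eta> f)) js ?y = real m *\<^sub>R (contract ?v ^^ m) (contract \<eta> f) js ?y"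
    by (cases m) auto
  finally show ?case
    by (simp add: contract_power_commute f scaleR_add_left add_ac)
qed

text \<open>
  The second relation in the introduction. The factor \<open>t\<close> in the velocity of the base point raises
  the order of the moment by one.
\<close>

lemma line_moment_pencil_derivative:
  assumes f: "f \<in> symmetric_schwartz" and \<theta>: "\<theta> \<noteq> 0"
  shows "((\<lambda>c. line_moment q ((contract (\<theta> + c *\<^sub>R \<eta>) ^^ m) f []) x (\<theta> + c *\<^sub>R \<eta>)) has_vector_derivative
     line_moment (Suc q) (dirderiv \<eta> ((contract \<theta> ^^ m) f [])) x \<theta> +
     real m *\<^sub>R line_moment q ((contract \<theta> ^^ (m - 1)) (contract \<eta> f) []) x \<theta>) (at 0)"
proof -
  \<comment> \<open>With this \<open>\<delta>\<close> the directions \<open>\<theta> + c \<eta>\<close> have norm between half and twice that of \<open>\<theta>\<close>.\<close>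
  define \<delta> where "\<delta> = norm \<theta> / 2 / (norm \<eta> + 1)"
  have \<delta>: "\<delta> > 0" using \<theta> by (simp add: \<delta>_def add_nonneg_pos)
  have "norm \<eta> + 1 > 0" using norm_ge_zero[of \<eta>] by linarith
  then have "\<delta> * (norm \<eta> + 1) = norm \<theta> / 2" by (metis \<delta>_def less_irrefl nonzero_eq_divide_eq)
  moreover have "\<delta> * norm \<eta> \<le> \<delta> * (norm \<eta> + 1)" using \<delta> by (intro mult_left_mono) auto
  ultimately have "\<delta> * norm \<eta> \<le> norm \<theta> / 2" by simp
  then have near: "norm (c *\<^sub>R \<eta>) \<le> norm \<theta> / 2" if "\<bar>c\<bar> < \<delta>" for c
    using mult_right_mono[OF less_imp_le[OF that], of "norm \<eta>"] by simp
  have lower: "norm (\<theta> + c *\<^sub>R \<eta>) \<ge> norm \<theta> / 2" and upper: "norm (\<theta> + c *\<^sub>R \<eta>) \<le> 2 * norm \<theta>"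
    if "\<bar>c\<bar> < \<delta>" for c
    using near[OF that] norm_triangle_ineq[of \<theta> "c *\<^sub>R \<eta>"] norm_diff_ineq[of \<theta> "c *\<^sub>R \<eta>"] norm_ge_zero[of \<theta>] by linarith+
  have nz: "\<theta> + c *\<^sub>R \<eta> \<noteq> 0" if "\<bar>c\<bar> < \<delta>" for c using lower[OF that] \<theta> by auto
  define A where "A = (1 + norm x) / (norm \<theta> / 2)"
  have line: "\<bar>t\<bar> \<le> A * (1 + norm (x + t *\<^sub>R (\<theta> + c *\<^sub>R \<eta>)))" if "\<bar>c\<bar> < \<delta>" for c t
    unfolding A_def using lower[OF that] \<theta> by (intro line_parameter_bound) auto
  let ?F = "\<lambda>c t. t ^ q *\<^sub>R (contract (\<theta> + c *\<^sub>R \<eta>) ^^ m) f [] (x + t *\<^sub>R (\<theta> + c *\<^sub>R \<eta>))"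
  let ?G = "\<lambda>c t. (contract (\<theta> + c *\<^sub>R \<eta>) ^^ (m - 1)) (contract \<eta> f) [] (x + t *\<^sub>R (\<theta> + c *\<^sub>R \<eta>))"
  let ?H = "\<lambda>c t. (contract (\<theta> + c *\<^sub>R \<eta>) ^^ m) (tensor_dirderiv \<eta> f) [] (x + t *\<^sub>R (\<theta> + c *\<^sub>R \<eta>))"
  let ?F' = "\<lambda>c t. t ^ Suc q *\<^sub>R ?H c t + real m *\<^sub>R t ^ q *\<^sub>R ?G c t"
  obtain C1 where C1: "\<And>v y t. \<lbrakk>norm v \<le> 2 * norm \<theta>; \<bar>t\<bar> \<le> A * (1 + norm y)\<rbrakk> \<Longrightarrow>
    \<bar>t\<bar> ^ Suc q * norm ((contract v ^^ m) (tensor_dirderiv \<eta> f) [] y) \<le> C1 / (1 + t\<^sup>2)"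
    using contract_power_decay[OF tensor_dirderiv_closed[OF f], of "2 * norm \<theta>" A "Suc q" m] by blast
  obtain C2 where C2: "\<And>v y t. \<lbrakk>norm v \<le> 2 * norm \<theta>; \<bar>t\<bar> \<le> A * (1 + norm y)\<rbrakk> \<Longrightarrow>
    \<bar>t\<bar> ^ q * norm ((contract v ^^ (m - 1)) (contract \<eta> f) [] y) \<le> C2 / (1 + t\<^sup>2)"
    using contract_power_decay[OF contract_closed[OF f], of "2 * norm \<theta>" A q "m - 1"] by blast
  have schw: "schwartz ((contract v ^^ m) f [])" "schwartz ((contract v ^^ (m - 1)) (contract \<eta> f) [])"
    "schwartz ((contract v ^^ m) (tensor_dirderiv \<eta> f) [])" for v
    by (intro symmetric_schwartzD(2) contract_power_closed contract_closed tensor_dirderiv_closed f)+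
  have int1: "integrable lborel (\<lambda>t. t ^ Suc q *\<^sub>R ?H 0 t)" and int2: "integrable lborel (\<lambda>t. t ^ q *\<^sub>R ?G 0 t)"
    using line_moment_integrable[OF schw(3) \<theta>, of "Suc q"] line_moment_integrable[OF schw(2) \<theta>, of q] by simp_all
  have "((\<lambda>c. integral\<^sup>L lborel (?F c)) has_vector_derivative integral\<^sup>L lborel (?F' 0)) (at 0)"
  proof (rule has_vector_derivative_integral[OF \<delta>, where B = "\<lambda>t. C1 / (1 + t\<^sup>2) + real m * (C2 / (1 + t\<^sup>2))"])
    fix c t assume "\<bar>c\<bar> < \<delta>"
    note b = upper[OF this] line[OF this, of t]
    show "norm (?F' c t) \<le> C1 / (1 + t\<^sup>2) + real m * (C2 / (1 + t\<^sup>2))"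
    proof (rule norm_triangle_le, rule add_mono)
      show "norm (t ^ Suc q *\<^sub>R ?H c t) \<le> C1 / (1 + t\<^sup>2)"
        using C1[OF b] by (simp add: power_abs abs_mult)
      show "norm (real m *\<^sub>R t ^ q *\<^sub>R ?G c t) \<le> real m * (C2 / (1 + t\<^sup>2))"
        using mult_left_mono[OF C2[OF b], of "real m"] by (simp add: power_abs mult.assoc abs_mult)
    qed
  next
    fix c t
    show "((\<lambda>c. ?F c t) has_vector_derivative ?F' c t) (at c)"
      by (rule has_vector_derivative_eq_rhs[OF bounded_linear.has_vector_derivative[OF bounded_linear_scaleR_right
          contract_power_pencil_derivative[OF f]]]) (simp add: scaleR_add_right mult.commute)
  next
    show "integrable lborel (?F c)" if "\<bar>c\<bar> < \<delta>" for c
      by (rule line_moment_integrable[OF schw(1) nz[OF that]])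
    show "integrable lborel (?F' 0)"
      by (intro Bochner_Integration.integrable_add int1 integrable_scaleR_right int2)
    show "integrable lborel (\<lambda>t. C1 / (1 + t\<^sup>2) + real m * (C2 / (1 + t\<^sup>2)))"
      by (intro Bochner_Integration.integrable_add integrable_mult_right integrable_const_over_1_plus_square)
  qed
  moreover have "integral\<^sup>L lborel (?F' 0) = line_moment (Suc q) ((contract \<theta> ^^ m) (tensor_dirderiv \<eta> f) []) x \<theta> +
     real m *\<^sub>R line_moment q ((contract \<theta> ^^ (m - 1)) (contract \<eta> f) []) x \<theta>"
    using Bochner_Integration.integral_add[OF int1 integrable_scaleR_right[OF int2]]
    by (simp add: line_moment_def del: scaleR_scaleR power_Suc)
  moreover have "(contract \<theta> ^^ m) (tensor_dirderiv \<eta> f) [] = dirderiv \<eta> ((contract \<theta> ^^ m) f [])"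
    using funpow_commute_on[of symmetric_schwartz "tensor_dirderiv \<eta>" "contract \<theta>" f 1 m]
    by (simp add: f tensor_dirderiv_closed contract_closed tensor_dirderiv_contract)
      (metis tensor_dirderiv_def)
  ultimately show ?thesis by (simp add: line_moment_def)
qed


text \<open>
  This is linear independence, in the form that also excludes \<open>\<eta> = \<xi>\<close>.
\<close>

definition noncollinear :: "'b::real_vector \<Rightarrow> 'b \<Rightarrow> bool" where
  "noncollinear \<eta> \<xi> \<longleftrightarrow> (\<forall>a b. a *\<^sub>R \<eta> + b *\<^sub>R \<xi> = 0 \<longrightarrow> a = 0 \<and> b = 0)"

lemma noncollinear_shear: "noncollinear \<eta> \<xi> \<Longrightarrow> noncollinear \<eta> (\<xi> + c *\<^sub>R \<eta>)"
  unfolding noncollinear_def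
proof (intro allI impI)
  fix a b
  assume *: "\<forall>a b. a *\<^sub>R \<eta> + b *\<^sub>R \<xi> = 0 \<longrightarrow> a = 0 \<and> b = 0" and "a *\<^sub>R \<eta> + b *\<^sub>R (\<xi> + c *\<^sub>R \<eta>) = 0"
  then have "(a + b * c) *\<^sub>R \<eta> + b *\<^sub>R \<xi> = 0" by (simp add: algebra_simps)
  with * have "a + b * c = 0 \<and> b = 0" by blast
  then show "a = 0 \<and> b = 0" by auto
qed

lemma noncollinear_commute: "noncollinear \<eta> \<xi> \<longleftrightarrow> noncollinear \<xi> \<eta>"
  unfolding noncollinear_def by (metis add.commute)

lemma noncollinear_nonzero: "noncollinear \<eta> \<xi> \<Longrightarrow> \<xi> \<noteq> 0"
  unfolding noncollinear_def by (metis add.right_neutral scaleR_zero_left scaleR_zero_right zero_neq_one)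

text \<open>
  An injective linear map from the coordinate plane is bounded below.
\<close>

lemma noncollinear_coordinate_bound:
  fixes \<eta> \<theta> x :: "'b::euclidean_space"
  assumes "noncollinear \<eta> \<theta>"
  shows "\<exists>A\<ge>0. \<forall>s t. \<bar>s\<bar> \<le> A * (1 + norm (x + s *\<^sub>R \<eta> + t *\<^sub>R \<theta>)) \<and> \<bar>t\<bar> \<le> A * (1 + norm (x + s *\<^sub>R \<eta> + t *\<^sub>R \<theta>))"
proof -
  let ?f = "\<lambda>(s, t). s *\<^sub>R \<eta> + t *\<^sub>R \<theta>"
  have lin: "linear ?f"
    by (rule linearI) (auto simp: algebra_simps)
  moreover have "inj ?f"
    using assms unfolding linear_injective_0[OF lin] noncollinear_def by (auto simp: zero_prod_def)
  ultimately obtain B where B: "B > 0" "\<And>p. B * norm p \<le> norm (?f p)"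
    by (rule linear_inj_bounded_below_pos) blast
  define A where "A = (1 + norm x) / B"
  have "\<bar>s\<bar> \<le> A * (1 + norm (x + s *\<^sub>R \<eta> + t *\<^sub>R \<theta>)) \<and> \<bar>t\<bar> \<le> A * (1 + norm (x + s *\<^sub>R \<eta> + t *\<^sub>R \<theta>))" for s t
  proof -
    let ?y = "x + s *\<^sub>R \<eta> + t *\<^sub>R \<theta>"
    have "B * norm (s, t) \<le> norm (?y - x)" using B(2)[of "(s, t)"] by (simp add: algebra_simps)
    also have "\<dots> \<le> norm ?y + norm x" by (rule norm_triangle_ineq4)
    also have "\<dots> \<le> (1 + norm x) * (1 + norm ?y)"
      by (simp add: algebra_simps)
    finally have "norm (s, t) \<le> A * (1 + norm ?y)"
      using B(1) by (simp add: A_def field_simps)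
    then show ?thesis
      using norm_fst_le[of s t] norm_snd_le[of t s] by simp
  qed
  moreover have "A \<ge> 0" using B(1) by (simp add: A_def)
  ultimately show ?thesis by blast
qed

lemma line_moment_tendsto_zero:
  assumes u: "schwartz u" and nc: "noncollinear \<eta> \<theta>"
  shows "((\<lambda>s. line_moment q u (x + s *\<^sub>R \<eta>) \<theta>) \<longlongrightarrow> 0) at_top"
proof -
  obtain A where A: "\<And>s t. \<bar>s\<bar> \<le> A * (1 + norm (x + s *\<^sub>R \<eta> + t *\<^sub>R \<theta>))" "\<And>s t. \<bar>t\<bar> \<le> A * (1 + norm (x + s *\<^sub>R \<eta> + t *\<^sub>R \<theta>))"
    using noncollinear_coordinate_bound[OF nc, of x] by blast
  obtain C where C: "\<And>y s t. \<lbrakk>\<bar>s\<bar> \<le> A * (1 + norm y); \<bar>t\<bar> \<le> A * (1 + norm y)\<rbrakk> \<Longrightarrow>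
    \<bar>t\<bar> ^ q * norm (u y) \<le> C / ((1 + s\<^sup>2) * (1 + t\<^sup>2))"
    using schwartz_plane_decay[OF u, of A q] by blast
  define K where "K = (\<integral>t. C / (1 + t\<^sup>2) \<partial>lborel)"
  have "norm (line_moment q u (x + s *\<^sub>R \<eta>) \<theta>) \<le> K / (1 + s\<^sup>2)" for s
  proof -
    have "norm (line_moment q u (x + s *\<^sub>R \<eta>) \<theta>) \<le> (\<integral>t. (C / (1 + t\<^sup>2)) / (1 + s\<^sup>2) \<partial>lborel)"
      unfolding line_moment_def
    proof (rule Bochner_Integration.integral_norm_bound_integral)
      show "norm (t ^ q *\<^sub>R u (x + s *\<^sub>R \<eta> + t *\<^sub>R \<theta>)) \<le> C / (1 + t\<^sup>2) / (1 + s\<^sup>2)" for t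
        using C[OF A, of t s] by (simp add: power_abs mult.commute)
      show "integrable lborel (\<lambda>t. C / (1 + t\<^sup>2) / (1 + s\<^sup>2))"
        by (rule integrable_divide[OF integrable_const_over_1_plus_square])
    qed (rule line_moment_integrable[OF u noncollinear_nonzero[OF nc]])
    also have "\<dots> = K / (1 + s\<^sup>2)"
      unfolding K_def by (rule integral_divide_zero)
    finally show ?thesis .
  qed
  moreover have "((\<lambda>s::real. K / (1 + s\<^sup>2)) \<longlongrightarrow> 0) at_top"
    by (intro tendsto_divide_0[OF tendsto_const] filterlim_at_top_imp_at_infinity
        filterlim_tendsto_add_at_top[OF tendsto_const] filterlim_pow_at_top filterlim_ident) auto
  ultimately show ?thesis
    by (rule Lim_null_comparison[OF always_eventually[OF allI]])
qed

text \<open>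
  The moment is constant along \<open>\<eta>\<close> and tends to zero there.
\<close>

lemma line_moment_eq_zero_if_transverse_zero:
  assumes u: "schwartz u" and nc: "noncollinear \<eta> \<theta>"
    and zero: "\<And>x. line_moment q (dirderiv \<eta> u) x \<theta> = 0"
  shows "line_moment q u x \<theta> = 0"
proof -
  have "((\<lambda>s. line_moment q u (x + s *\<^sub>R \<eta>) \<theta>) has_vector_derivative 0) (at a within UNIV)" for a
    using line_moment_transverse_derivative[OF u noncollinear_nonzero[OF nc], where q = q and x = x and \<eta> = \<eta> and a = a] by (simp add: zero)
  then obtain c where c: "\<And>s. line_moment q u (x + s *\<^sub>R \<eta>) \<theta> = c"
    using has_vector_derivative_zero_constant[of UNIV "\<lambda>s. line_moment q u (x + s *\<^sub>R \<eta>) \<theta>"] by auto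
  then have "((\<lambda>s::real. c) \<longlongrightarrow> 0) at_top"
    using line_moment_tendsto_zero[OF u nc, of q x] by simp
  then have "c = 0" by (simp add: tendsto_const_iff)
  then show ?thesis using c[of 0] by simp
qed

text \<open>
  The \<open>q\<close>-th moment of \<open>f\<close>, taken as a field of rank \<open>m\<close>, vanishes on all lines whose direction
  belongs to the pencil \<open>\<xi> + c \<eta>\<close>. Allowing every \<open>c\<close> makes it possible to differentiate in \<open>c\<close>.
\<close>

definition pencil_moments_vanish ::
    "nat \<Rightarrow> nat \<Rightarrow> real ^ 'n::finite \<Rightarrow> real ^ 'n \<Rightarrow> ('n, 'a::euclidean_space) tensor_field \<Rightarrow> bool" where
  "pencil_moments_vanish q m \<eta> \<xi> f \<longleftrightarrow>
     (\<forall>c x. line_moment q ((contract (\<xi> + c *\<^sub>R \<eta>) ^^ m) f []) x (\<xi> + c *\<^sub>R \<eta>) = 0)"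

lemma pencil_transverse_zero:
  assumes f: "f \<in> symmetric_schwartz" and nc: "noncollinear \<eta> \<xi>" and v: "pencil_moments_vanish q m \<eta> \<xi> f"
  shows "line_moment q (dirderiv \<eta> ((contract (\<xi> + c *\<^sub>R \<eta>) ^^ m) f [])) x (\<xi> + c *\<^sub>R \<eta>) = 0"
proof -
  let ?\<theta> = "\<xi> + c *\<^sub>R \<eta>"
  let ?w = "(contract ?\<theta> ^^ m) f []"
  have w: "schwartz ?w" by (intro symmetric_schwartzD(2) contract_power_closed f)
  have "((\<lambda>s. line_moment q ?w (x + s *\<^sub>R \<eta>) ?\<theta>) has_vector_derivative line_moment q (dirderiv \<eta> ?w) (x + 0 *\<^sub>R \<eta>) ?\<theta>) (at 0)"
    by (rule line_moment_transverse_derivative[OF w noncollinear_nonzero[OF noncollinear_shear[OF nc]]])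
  also have "(\<lambda>s. line_moment q ?w (x + s *\<^sub>R \<eta>) ?\<theta>) = (\<lambda>s. 0)"
    using v unfolding pencil_moments_vanish_def by blast
  finally have "line_moment q (dirderiv \<eta> ?w) (x + 0 *\<^sub>R \<eta>) ?\<theta> = 0"
    by (rule vector_derivative_unique_at[OF _ has_vector_derivative_const])
  then show ?thesis by simp
qed

lemma pencil_derivative_zero:
  assumes f: "f \<in> symmetric_schwartz" and nc: "noncollinear \<eta> \<xi>" and v: "pencil_moments_vanish q m \<eta> \<xi> f"
  shows "line_moment (Suc q) (dirderiv \<eta> ((contract (\<xi> + c *\<^sub>R \<eta>) ^^ m) f [])) x (\<xi> + c *\<^sub>R \<eta>) +
     real m *\<^sub>R line_moment q ((contract (\<xi> + c *\<^sub>R \<eta>) ^^ (m - 1)) (contract \<eta> f) []) x (\<xi> + c *\<^sub>R \<eta>) = 0"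
proof -
  let ?\<theta> = "\<xi> + c *\<^sub>R \<eta>"
  have "(\<lambda>b. line_moment q ((contract (?\<theta> + b *\<^sub>R \<eta>) ^^ m) f []) x (?\<theta> + b *\<^sub>R \<eta>)) = (\<lambda>b. 0)"
  proof
    fix b
    have "?\<theta> + b *\<^sub>R \<eta> = \<xi> + (c + b) *\<^sub>R \<eta>" by (simp add: algebra_simps)
    then show "line_moment q ((contract (?\<theta> + b *\<^sub>R \<eta>) ^^ m) f []) x (?\<theta> + b *\<^sub>R \<eta>) = 0"
      using v unfolding pencil_moments_vanish_def by metis
  qed
  with line_moment_pencil_derivative[OF f noncollinear_nonzero[OF noncollinear_shear[OF nc, of c]],
      where q = q and \<eta> = \<eta> and m = m and x = x]
  have "((\<lambda>b. 0) has_vector_derivative line_moment (Suc q) (dirderiv \<eta> ((contract ?\<theta> ^^ m) f [])) x ?\<theta> +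
     real m *\<^sub>R line_moment q ((contract ?\<theta> ^^ (m - 1)) (contract \<eta> f) []) x ?\<theta>) (at (0::real))"
    by (simp only:)
  from vector_derivative_unique_at[OF this has_vector_derivative_const] show ?thesis .
qed

text \<open>
  Both derivatives in the second relation vanish, hence so does the contracted term. Two
  consecutive moments are used up to obtain one.
\<close>

lemma pencil_moments_vanish_contract:
  assumes f: "f \<in> symmetric_schwartz" and nc: "noncollinear \<eta> \<xi>"
    and v: "pencil_moments_vanish q (Suc m) \<eta> \<xi> f" "pencil_moments_vanish (Suc q) (Suc m) \<eta> \<xi> f"
  shows "pencil_moments_vanish q m \<eta> \<xi> (contract \<eta> f)"
  unfolding pencil_moments_vanish_def
  using pencil_derivative_zero[OF f nc v(1)] pencil_transverse_zero[OF f nc v(2)]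
  by (simp del: funpow.simps)

text \<open>
  The first relation in the introduction. By \<open>plane_curl_shear\<close> the operator may be formed with the
  direction of the line itself, and then its first term is integrated by parts.
\<close>

lemma line_moment_plane_curl:
  assumes f: "f \<in> symmetric_schwartz" and nc: "noncollinear \<eta> \<xi>"
  shows "line_moment q ((contract (\<xi> + c *\<^sub>R \<eta>) ^^ m) (plane_curl \<eta> \<xi> f) []) x (\<xi> + c *\<^sub>R \<eta>) =
     - (real q *\<^sub>R line_moment (q - 1) ((contract (\<xi> + c *\<^sub>R \<eta>) ^^ m) (contract \<eta> f) []) x (\<xi> + c *\<^sub>R \<eta>))
     - line_moment q (dirderiv \<eta> ((contract (\<xi> + c *\<^sub>R \<eta>) ^^ Suc m) f [])) x (\<xi> + c *\<^sub>R \<eta>)"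
proof -
  let ?\<theta> = "\<xi> + c *\<^sub>R \<eta>"
  let ?v = "(contract ?\<theta> ^^ m) (contract \<eta> f) []" and ?w = "(contract ?\<theta> ^^ Suc m) f []"
  have s: "schwartz ?v" "schwartz ?w"
    by (intro symmetric_schwartzD(2) contract_power_closed contract_closed f)+
  have nz: "?\<theta> \<noteq> 0" by (intro noncollinear_nonzero[OF noncollinear_shear[OF nc]])
  have "(contract ?\<theta> ^^ m) (plane_curl \<eta> \<xi> f) = (contract ?\<theta> ^^ m) (plane_curl \<eta> ?\<theta> f)"
    by (simp add: plane_curl_shear f)
  also have "\<dots> = plane_curl \<eta> ?\<theta> ((contract ?\<theta> ^^ m) f)"
    using funpow_commute_on[of symmetric_schwartz "contract ?\<theta>" "plane_curl \<eta> ?\<theta>" f m 1]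
    by (simp add: f contract_closed plane_curl_closed contract_plane_curl)
  finally have "(contract ?\<theta> ^^ m) (plane_curl \<eta> \<xi> f) [] = (\<lambda>x. dirderiv ?\<theta> ?v x - dirderiv \<eta> ?w x)"
    by (simp add: plane_curl_def tensor_dirderiv_def contract_power_commute f)
  then show ?thesis
    by (simp add: line_moment_diff schwartz_dirderiv s nz line_moment_longitudinal_derivative del: funpow.simps)
qed

lemma pencil_moments_vanish_plane_curl:
  assumes f: "f \<in> symmetric_schwartz" and nc: "noncollinear \<eta> \<xi>"
    and v: "\<And>q. q \<le> k \<Longrightarrow> pencil_moments_vanish q (Suc m) \<eta> \<xi> f" and q: "q \<le> k"
  shows "pencil_moments_vanish q m \<eta> \<xi> (plane_curl \<eta> \<xi> f)"
  unfolding pencil_moments_vanish_def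
proof (intro allI)
  fix c x
  have "real q *\<^sub>R line_moment (q - 1) ((contract (\<xi> + c *\<^sub>R \<eta>) ^^ m) (contract \<eta> f) []) x (\<xi> + c *\<^sub>R \<eta>) = 0"
  proof (cases q)
    case (Suc p)
    then have "pencil_moments_vanish p m \<eta> \<xi> (contract \<eta> f)"
      using v q by (intro pencil_moments_vanish_contract f nc) auto
    then show ?thesis by (simp add: Suc pencil_moments_vanish_def)
  qed simp
  then show "line_moment q ((contract (\<xi> + c *\<^sub>R \<eta>) ^^ m) (plane_curl \<eta> \<xi> f) []) x (\<xi> + c *\<^sub>R \<eta>) = 0"
    unfolding line_moment_plane_curl[OF f nc] using pencil_transverse_zero[OF f nc v[OF q]] by simp
qed

text \<open>
  Induction on \<open>q\<close>: the two relations are linear equations for \<open>J\<^sup>q\<^sup>-\<^sup>1 f(\<eta>, \<dots>)\<close> and \<open>\<partial>\<^sub>\<eta> J\<^sup>q f\<close> with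
  determinant proportional to \<open>m + 1 - q\<close>, which is where \<open>k \<le> m\<close> enters.
\<close>

lemma pencil_moments_vanish_from_plane_curl:
  assumes f: "f \<in> symmetric_schwartz" and nc: "noncollinear \<eta> \<xi>" and k: "k \<le> m"
    and v: "\<And>q. q \<le> k \<Longrightarrow> pencil_moments_vanish q m \<eta> \<xi> (plane_curl \<eta> \<xi> f)"
  shows "q \<le> k \<Longrightarrow> pencil_moments_vanish q (Suc m) \<eta> \<xi> f"
proof (induction q)
  case 0
  show ?case
    unfolding pencil_moments_vanish_def
  proof (intro allI)
    fix c x
    show "line_moment 0 ((contract (\<xi> + c *\<^sub>R \<eta>) ^^ Suc m) f []) x (\<xi> + c *\<^sub>R \<eta>) = 0"
    proof (rule line_moment_eq_zero_if_transverse_zero[OF _ noncollinear_shear[OF nc]])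
      show "schwartz ((contract (\<xi> + c *\<^sub>R \<eta>) ^^ Suc m) f [])"
        by (intro symmetric_schwartzD(2) contract_power_closed f)
      show "line_moment 0 (dirderiv \<eta> ((contract (\<xi> + c *\<^sub>R \<eta>) ^^ Suc m) f [])) x (\<xi> + c *\<^sub>R \<eta>) = 0" for x
        using v[OF 0] unfolding pencil_moments_vanish_def line_moment_plane_curl[OF f nc] by simp
    qed
  qed
next
  case (Suc q)
  show ?case
    unfolding pencil_moments_vanish_def
  proof (intro allI)
    fix c x
    let ?\<theta> = "\<xi> + c *\<^sub>R \<eta>"
    have "line_moment (Suc q) (dirderiv \<eta> ((contract ?\<theta> ^^ Suc m) f [])) x ?\<theta> = 0" for x
    proof -
      define a where "a = line_moment q ((contract ?\<theta> ^^ m) (contract \<eta> f) []) x ?\<theta>"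
      define b where "b = line_moment (Suc q) (dirderiv \<eta> ((contract ?\<theta> ^^ Suc m) f [])) x ?\<theta>"
      have "b + real (Suc m) *\<^sub>R a = 0"
        using pencil_derivative_zero[OF f nc Suc.IH, where c = c and x = x] Suc.prems
        by (simp add: a_def b_def del: funpow.simps of_nat_Suc)
      moreover have "- (real (Suc q) *\<^sub>R a) - b = 0"
        using v[OF Suc.prems] line_moment_plane_curl[OF f nc, where q = "Suc q" and c = c and m = m and x = x]
        by (simp add: a_def b_def pencil_moments_vanish_def del: funpow.simps of_nat_Suc)
      ultimately have "(real (Suc m) - real (Suc q)) *\<^sub>R a = 0"
        unfolding scaleR_diff_left by (auto simp del: of_nat_Suc)
      with Suc.prems k have "a = 0" by simp
      with \<open>b + real (Suc m) *\<^sub>R a = 0\<close> show ?thesis by (simp add: b_def)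
    qed
    then show "line_moment (Suc q) ((contract ?\<theta> ^^ Suc m) f []) x ?\<theta> = 0"
      by (rule line_moment_eq_zero_if_transverse_zero[OF symmetric_schwartzD(2)[OF contract_power_closed[OF f]]
        noncollinear_shear[OF nc]])
  qed
qed

lemma plane_curl_power_closed:
  "f \<in> symmetric_schwartz \<Longrightarrow> (plane_curl \<eta> \<xi> ^^ r) f \<in> symmetric_schwartz"
  by (rule funpow_closed) (rule plane_curl_closed)

theorem pencil_moments_vanish_iff_plane_curl_power:
  assumes f: "f \<in> symmetric_schwartz" and nc: "noncollinear \<eta> \<xi>" and k: "k \<le> m"
  shows "(\<forall>q\<le>k. pencil_moments_vanish q (r + m) \<eta> \<xi> f) \<longleftrightarrow>
    (\<forall>q\<le>k. pencil_moments_vanish q m \<eta> \<xi> ((plane_curl \<eta> \<xi> ^^ r) f))"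
  using f
proof (induction r arbitrary: f)
  case (Suc r)
  have "(\<forall>q\<le>k. pencil_moments_vanish q (Suc r + m) \<eta> \<xi> f) \<longleftrightarrow>
      (\<forall>q\<le>k. pencil_moments_vanish q (r + m) \<eta> \<xi> (plane_curl \<eta> \<xi> f))"
    using pencil_moments_vanish_plane_curl[OF Suc.prems nc, of k "r + m"]
      pencil_moments_vanish_from_plane_curl[OF Suc.prems nc, of k "r + m"] k by auto
  with Suc.IH[OF plane_curl_closed[OF Suc.prems]] show ?case
    by (simp only: funpow_Suc_right o_apply)
qed simp

text \<open>
  A field of rank \<open>k\<close> has just enough vanishing moments for all its slots to be filled with \<open>\<eta>\<close>.
\<close>

lemma pencil_moments_vanish_contract_power:
  assumes f: "f \<in> symmetric_schwartz" and nc: "noncollinear \<eta> \<xi>"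
    and v: "\<And>q. q \<le> k \<Longrightarrow> pencil_moments_vanish q k \<eta> \<xi> f"
  shows "pencil_moments_vanish 0 0 \<eta> \<xi> ((contract \<eta> ^^ k) f)"
  using f v
proof (induction k arbitrary: f)
  case (Suc k)
  have "pencil_moments_vanish q k \<eta> \<xi> (contract \<eta> f)" if "q \<le> k" for q
    using Suc.prems that by (intro pencil_moments_vanish_contract nc) auto
  from Suc.IH[OF contract_closed[OF Suc.prems(1)] this] show ?case
    by (simp only: funpow_Suc_right o_apply)
qed simp

section \<open>Injectivity of the X-ray transform in a plane\<close>

lemma continuous_borel_measurable_lborel:
  fixes g :: "'b::euclidean_space \<Rightarrow> 'c::euclidean_space"
  shows "continuous_on UNIV g \<Longrightarrow> g \<in> borel_measurable lborel"
  by (simp add: borel_measurable_continuous_onI)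

text \<open>
  The set where \<open>g\<close> does not vanish is open and null, hence empty.
\<close>

lemma continuous_AE_zero:
  fixes g :: "'b::euclidean_space \<Rightarrow> 'c::real_normed_vector"
  assumes g: "continuous_on UNIV g" and ae: "AE x in lborel. g x = 0"
  shows "g x = 0"
proof (rule ccontr)
  assume "g x \<noteq> 0"
  have op: "open {x. g x \<noteq> 0}"
    using open_vimage[OF _ g, of "- {0}"] by (simp add: vimage_def open_Compl)
  moreover have "{x. g x \<noteq> 0} \<in> null_sets lborel"
    using AE_E2[OF ae] op borel_closed[OF closed_Collect_eq[OF g continuous_on_const[of _ 0]]]
    by (auto intro!: null_setsI)
  ultimately show False
    using \<open>g x \<noteq> 0\<close> open_not_negligible[OF op] null_sets_completionI[of _ lborel]
    unfolding negligible_iff_null_sets by blast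
qed

text \<open>
  Levy's uniqueness theorem for characteristic functions, in terms of densities.
\<close>

lemma nonneg_density_eq_if_fourier_eq:
  fixes h1 h2 :: "real \<Rightarrow> real"
  assumes int: "integrable lborel h1" "integrable lborel h2"
    and nn: "\<And>t. 0 \<le> h1 t" "\<And>t. 0 \<le> h2 t"
    and mass: "integral\<^sup>L lborel h1 = 1" "integral\<^sup>L lborel h2 = 1"
    and eq: "\<And>\<tau>. (CLINT t|lborel. h1 t *\<^sub>R iexp (\<tau> * t)) = (CLINT t|lborel. h2 t *\<^sub>R iexp (\<tau> * t))"
  shows "AE t in lborel. h1 t = h2 t"
proof -
  have dist: "real_distribution (density lborel h)" if "integrable lborel h" "\<And>t. 0 \<le> h t" "integral\<^sup>L lborel h = 1" for h :: "real \<Rightarrow> real"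
  proof -
    have "emeasure (density lborel h) (space (density lborel h)) = (\<integral>\<^sup>+ t. ennreal (h t) \<partial>lborel)"
      using that by (simp add: emeasure_density)
    also have "\<dots> = 1"
      using that by (simp add: nn_integral_eq_integral)
    finally have "prob_space (density lborel h)" by (rule prob_spaceI)
    then show ?thesis
      by (rule real_distribution.intro) (simp add: real_distribution_axioms_def)
  qed
  have ch: "char (density lborel h) \<tau> = (CLINT t|lborel. h t *\<^sub>R iexp (\<tau> * t))" if "integrable lborel h" "\<And>t. 0 \<le> h t" for h :: "real \<Rightarrow> real" and \<tau>
    unfolding char_def using that by (intro integral_density) (auto intro!: borel_measurable_continuous_onI continuous_intros)
  have "density lborel h1 = density lborel h2"
    by (intro Levy_uniqueness dist int nn mass) (rule ext, simp only: ch[OF int(1) nn(1)] ch[OF int(2) nn(2)] eq)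
  then have "AE t in lborel. ennreal (h1 t) = ennreal (h2 t)"
    using int by (intro sigma_finite_measure.density_unique[OF sigma_finite_lborel]) auto
  then show ?thesis by eventually_elim (simp add: nn)
qed

text \<open>
  The positive and the negative part of \<open>g\<close> have the same Fourier transform. Adding a normal density
  to both makes them normalizable to probability densities without distinguishing the case \<open>g = 0\<close>.
\<close>

lemma fourier_uniqueness_real:
  fixes g :: "real \<Rightarrow> real"
  assumes g: "continuous_on UNIV g" "integrable lborel g"
    and zero: "\<And>\<tau>. (CLINT t|lborel. g t *\<^sub>R iexp (\<tau> * t)) = 0"
  shows "g t = 0"
proof -
  let ?n = "normal_density 0 1"
  have int_exp: "integrable lborel (\<lambda>t. h t *\<^sub>R iexp (\<tau> * t))" if "integrable lborel h" for h \<tau>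
    by (rule Bochner_Integration.integrable_bound[OF that])
      (use that in \<open>auto intro!: borel_measurable_scaleR borel_measurable_integrable borel_measurable_continuous_onI continuous_intros\<close>)
  define p where "p t = max (g t) 0" for t
  define Z where "Z = integral\<^sup>L lborel p + 1"
  have p: "integrable lborel p" unfolding p_def using g by (intro Bochner_Integration.integrable_max) auto
  have "integral\<^sup>L lborel p \<ge> 0" by (intro Bochner_Integration.integral_nonneg_AE) (simp add: p_def)
  then have Z: "Z > 0" by (simp add: Z_def)
  \<comment> \<open>\<open>p - g\<close> is the negative part of \<open>g\<close>, and both parts have the same integral by \<open>zero\<close> at \<open>\<tau> = 0\<close>.\<close>
  define h1 where "h1 t = (p t + ?n t) / Z" for t
  define h2 where "h2 t = (p t - g t + ?n t) / Z" for t
  have int: "integrable lborel h1" "integrable lborel h2"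
    unfolding h1_def h2_def by (intro integrable_divide Bochner_Integration.integrable_add Bochner_Integration.integrable_diff p g; simp)+
  have diff: "h1 t - h2 t = g t / Z" for t by (simp add: h1_def h2_def add_divide_distrib diff_divide_distrib)
  have "complex_of_real (integral\<^sup>L lborel g) = 0" using zero[of 0] by (simp add: scaleR_conv_of_real)
  then have g0: "integral\<^sup>L lborel g = 0" by simp
  have "AE t in lborel. h1 t = h2 t"
  proof (rule nonneg_density_eq_if_fourier_eq[OF int])
    show "0 \<le> h1 t" "0 \<le> h2 t" for t
      using Z by (auto simp: h1_def h2_def p_def intro!: divide_nonneg_pos add_nonneg_nonneg)
    show "integral\<^sup>L lborel h1 = 1"
      unfolding h1_def using Z p by (simp add: Z_def)
    then show "integral\<^sup>L lborel h2 = 1"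
      using Bochner_Integration.integral_diff[OF int] g0 by (simp add: diff)
    fix \<tau>
    have "(CLINT t|lborel. h1 t *\<^sub>R iexp (\<tau> * t)) - (CLINT t|lborel. h2 t *\<^sub>R iexp (\<tau> * t)) =
        (CLINT t|lborel. (1 / Z) *\<^sub>R (g t *\<^sub>R iexp (\<tau> * t)))"
      by (subst Bochner_Integration.integral_diff[OF int_exp[OF int(1)] int_exp[OF int(2)], symmetric])
        (simp add: scaleR_diff_left[symmetric] diff)
    also have "\<dots> = 0" by (simp only: integral_scaleR_right zero scaleR_zero_right)
    finally show "(CLINT t|lborel. h1 t *\<^sub>R iexp (\<tau> * t)) = (CLINT t|lborel. h2 t *\<^sub>R iexp (\<tau> * t))" by simp
  qed
  then have "AE t in lborel. g t = 0"
  proof eventually_elim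
    case (elim t)
    then have "g t / Z = 0" using diff[of t] by simp
    then show ?case using Z by simp
  qed
  then show ?thesis by (rule continuous_AE_zero[OF g(1)])
qed

text \<open>
  Conjugation replaces \<open>\<tau>\<close> by \<open>- \<tau>\<close>, so the Fourier transform of the conjugate of \<open>V\<close> vanishes too, and
  with it those of the real and imaginary parts.
\<close>

lemma fourier_uniqueness_complex:
  fixes V :: "real \<Rightarrow> complex"
  assumes V: "continuous_on UNIV V" "integrable lborel V"
    and zero: "\<And>\<tau>. (CLINT t|lborel. iexp (\<tau> * t) * V t) = 0"
  shows "V t = 0"
proof -
  have int_exp: "integrable lborel (\<lambda>t. iexp (\<tau> * t) * W t)" if "integrable lborel W" for W \<tau>
    by (rule Bochner_Integration.integrable_bound[OF that])
      (use that in \<open>auto simp: norm_mult intro!: borel_measurable_times borel_measurable_integrable borel_measurable_continuous_onI continuous_intros\<close>)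
  have conj: "(CLINT t|lborel. iexp (\<tau> * t) * cnj (V t)) = 0" for \<tau>
  proof -
    have "(CLINT t|lborel. iexp (\<tau> * t) * cnj (V t)) = (CLINT t|lborel. cnj (iexp (- \<tau> * t) * V t))"
      by (simp add: exp_cnj)
    also have "\<dots> = cnj (CLINT t|lborel. iexp (- \<tau> * t) * V t)" using Bochner_Integration.integral_cnj[of lborel "\<lambda>t. iexp (- \<tau> * t) * V t"] by simp
    finally show ?thesis using zero[of "- \<tau>"] by simp
  qed
  have intV: "integrable lborel (\<lambda>t. cnj (V t))" using V(2) by simp
  have "Re (V t) = 0"
  proof (rule fourier_uniqueness_real[of "\<lambda>t. Re (V t)"])
    fix \<tau>
    have "(CLINT t|lborel. Re (V t) *\<^sub>R iexp (\<tau> * t)) = (CLINT t|lborel. (1/2) * (iexp (\<tau> * t) * V t + iexp (\<tau> * t) * cnj (V t)))"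
      by (intro Bochner_Integration.integral_cong)
        (auto simp: scaleR_conv_of_real distrib_left[symmetric] complex_add_cnj)
    also have "\<dots> = 0"
      using int_exp[OF V(2), of \<tau>] int_exp[OF intV, of \<tau>] zero[of \<tau>] conj[of \<tau>] by simp
    finally show "(CLINT t|lborel. Re (V t) *\<^sub>R iexp (\<tau> * t)) = 0" .
  qed (use V in \<open>auto intro!: continuous_intros\<close>)
  moreover have "Im (V t) = 0"
  proof (rule fourier_uniqueness_real[of "\<lambda>t. Im (V t)"])
    fix \<tau>
    have "(CLINT t|lborel. Im (V t) *\<^sub>R iexp (\<tau> * t)) = (CLINT t|lborel. (1/(2 * \<i>)) * (iexp (\<tau> * t) * V t - iexp (\<tau> * t) * cnj (V t)))"
    proof (rule Bochner_Integration.integral_cong[OF refl])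
      fix t
      have "complex_of_real (Im (V t)) = (1/(2 * \<i>)) * (V t - cnj (V t))"
        by (simp add: complex_eq_iff)
      then have "complex_of_real (Im (V t)) * e = (1/(2 * \<i>)) * (e * V t - e * cnj (V t))" for e
        by (simp only: right_diff_distrib left_diff_distrib mult_ac)
      then show "Im (V t) *\<^sub>R iexp (\<tau> * t) = (1/(2 * \<i>)) * (iexp (\<tau> * t) * V t - iexp (\<tau> * t) * cnj (V t))"
        by (simp only: scaleR_conv_of_real)
    qed
    also have "\<dots> = 0"
      using int_exp[OF V(2), of \<tau>] int_exp[OF intV, of \<tau>] zero[of \<tau>] conj[of \<tau>] by simp
    finally show "(CLINT t|lborel. Im (V t) *\<^sub>R iexp (\<tau> * t)) = 0" .
  qed (use V in \<open>auto intro!: continuous_intros\<close>)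
  ultimately show ?thesis by (simp add: complex_eq_iff)
qed

lemma continuous_integral_dominated:
  fixes F :: "real \<Rightarrow> real \<Rightarrow> 'b::euclidean_space"
  assumes "\<And>t. continuous_on UNIV (\<lambda>c. F c t)"
    and "\<And>c. F c \<in> borel_measurable M" and "\<And>c t. norm (F c t) \<le> B t" and "integrable M B"
  shows "continuous_on UNIV (\<lambda>c. integral\<^sup>L M (F c))"
  unfolding continuous_on_sequentially
proof (intro allI ballI impI)
  fix X :: "nat \<Rightarrow> real" and a
  assume X: "(\<forall>n. X n \<in> UNIV) \<and> X \<longlonglongrightarrow> a"
  have "(\<lambda>n. integral\<^sup>L M (F (X n))) \<longlonglongrightarrow> integral\<^sup>L M (F a)"
  proof (rule integral_dominated_convergence[where w = B])
    show "AE t in M. (\<lambda>n. F (X n) t) \<longlonglongrightarrow> F a t"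
      using X assms(1) by (auto simp: continuous_on_sequentially o_def)
  qed (use assms in auto)
  then show "((\<lambda>c. integral\<^sup>L M (F c)) \<circ> X) \<longlonglongrightarrow> integral\<^sup>L M (F a)" by (simp add: o_def)
qed

lemma integrable_plane_if_bounded:
  fixes U :: "real \<times> real \<Rightarrow> 'b::euclidean_space"
  assumes "continuous_on UNIV U" and b: "\<And>s t. norm (U (s, t)) \<le> C / ((1 + s\<^sup>2) * (1 + t\<^sup>2))"
  shows "integrable (lborel \<Otimes>\<^sub>M lborel) U"
proof (rule Bochner_Integration.integrable_bound)
  have meas: "continuous_on UNIV f \<Longrightarrow> f \<in> borel_measurable (lborel \<Otimes>\<^sub>M lborel)" for f :: "real \<times> real \<Rightarrow> 'c::euclidean_space"
    by (simp add: lborel_prod borel_measurable_continuous_onI)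
  have pos: "(1 + (a::real)\<^sup>2) > 0" for a by (simp add: add_pos_nonneg)
  show "integrable (lborel \<Otimes>\<^sub>M lborel) (\<lambda>(s, t). C / (1 + (s::real)\<^sup>2) / (1 + (t::real)\<^sup>2))"
  proof (rule lborel_pair.Fubini_integrable)
    show "(\<lambda>(s, t). C / (1 + (s::real)\<^sup>2) / (1 + (t::real)\<^sup>2)) \<in> borel_measurable (lborel \<Otimes>\<^sub>M lborel)"
      unfolding case_prod_beta
      by (intro meas continuous_intros) (use pos in \<open>auto simp: less_imp_neq[symmetric]\<close>)
    have "(\<lambda>s::real. \<integral>t. norm (case (s, t) of (s, t) \<Rightarrow> C / (1 + s\<^sup>2) / (1 + t\<^sup>2)) \<partial>lborel) =
        (\<lambda>s. (\<integral>t. \<bar>C\<bar> / (1 + t\<^sup>2) \<partial>lborel) / (1 + s\<^sup>2))"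
    proof
      fix s :: real
      have "(\<integral>t. norm (case (s, t) of (s, t) \<Rightarrow> C / (1 + s\<^sup>2) / (1 + t\<^sup>2)) \<partial>lborel) = (\<integral>t. \<bar>C\<bar> / (1 + t\<^sup>2) / (1 + s\<^sup>2) \<partial>lborel)"
        using pos by (intro Bochner_Integration.integral_cong) (auto simp: abs_of_pos mult.commute)
      then show "(\<integral>t. norm (case (s, t) of (s, t) \<Rightarrow> C / (1 + s\<^sup>2) / (1 + t\<^sup>2)) \<partial>lborel) = (\<integral>t. \<bar>C\<bar> / (1 + t\<^sup>2) \<partial>lborel) / (1 + s\<^sup>2)"
        by (simp only: integral_divide_zero)
    qed
    then show "integrable lborel (\<lambda>s::real. \<integral>t. norm (case (s, t) of (s, t) \<Rightarrow> C / (1 + s\<^sup>2) / (1 + t\<^sup>2)) \<partial>lborel)"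
      by (simp only: integrable_const_over_1_plus_square)
    show "AE s in lborel. integrable lborel (\<lambda>t. case (s::real, t) of (s, t) \<Rightarrow> C / (1 + s\<^sup>2) / (1 + t\<^sup>2))"
      by (intro AE_I2) (simp only: prod.case integrable_const_over_1_plus_square)
  qed
  show "U \<in> borel_measurable (lborel \<Otimes>\<^sub>M lborel)" by (rule meas) fact
  show "AE p in lborel \<Otimes>\<^sub>M lborel. norm (U p) \<le> norm (case p of (s, t) \<Rightarrow> C / (1 + s\<^sup>2) / (1 + t\<^sup>2))"
  proof (intro AE_I2)
    fix p :: "real \<times> real"
    obtain s t where p: "p = (s, t)" by (cases p)
    show "norm (U p) \<le> norm (case p of (s, t) \<Rightarrow> C / (1 + s\<^sup>2) / (1 + t\<^sup>2))"
      using order_trans[OF b[of s t] abs_ge_self] unfolding p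
      by (simp only: prod.case real_norm_def divide_divide_eq_left)
  qed
qed


text \<open>
  The Fourier slice argument in coordinates \<open>(s, t)\<close> of the plane through \<open>x\<close>. The partial Fourier
  transform in \<open>s\<close> of the line integrals for slope \<open>c\<close> is the full Fourier transform at
  \<open>(\<sigma>, - \<sigma> c)\<close>. For \<open>\<sigma> \<noteq> 0\<close> these points exhaust the line over \<open>\<sigma>\<close>, so uniqueness in \<open>t\<close> applies;
  the excluded value \<open>\<sigma> = 0\<close> is recovered by continuity, and uniqueness in \<open>s\<close> finishes the proof.
\<close>

theorem plane_xray_injective:
  fixes u :: "real ^ 'n::finite \<Rightarrow> 'a::euclidean_space"
  assumes u: "schwartz u" and nc: "noncollinear \<eta> \<xi>"
    and zero: "\<And>c x. line_moment 0 u x (\<xi> + c *\<^sub>R \<eta>) = 0"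
  shows "u x = 0"
proof -
  have "u x \<bullet> b = 0" for b
  proof -
    define U where "U c s t = complex_of_real (u (x + s *\<^sub>R \<eta> + t *\<^sub>R (\<xi> + c *\<^sub>R \<eta>)) \<bullet> b)" for c s t
    have shear: "U c s t = U 0 (s + c * t) t" for c s t
      by (simp add: U_def algebra_simps)
    have bound: "\<exists>C. \<forall>s t. norm (U c s t) \<le> C / ((1 + s\<^sup>2) * (1 + t\<^sup>2))" for c
    proof -
      let ?y = "\<lambda>s t. x + s *\<^sub>R \<eta> + t *\<^sub>R (\<xi> + c *\<^sub>R \<eta>)"
      obtain A where A: "\<And>s t. \<bar>s\<bar> \<le> A * (1 + norm (?y s t))" "\<And>s t. \<bar>t\<bar> \<le> A * (1 + norm (?y s t))"
        using noncollinear_coordinate_bound[OF noncollinear_shear[OF nc, of c], of x] by blast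
      obtain C where C: "\<And>y s t. \<lbrakk>\<bar>s\<bar> \<le> A * (1 + norm y); \<bar>t\<bar> \<le> A * (1 + norm y)\<rbrakk> \<Longrightarrow>
        \<bar>t\<bar> ^ 0 * norm (u y) \<le> C / ((1 + s\<^sup>2) * (1 + t\<^sup>2))"
        using schwartz_plane_decay[OF u, of A 0] by blast
      have "norm (U c s t) \<le> (C * norm b) / ((1 + s\<^sup>2) * (1 + t\<^sup>2))" for s t
      proof -
        have "norm (U c s t) \<le> norm (u (?y s t)) * norm b"
          by (simp add: U_def Cauchy_Schwarz_ineq2)
        also have "\<dots> \<le> C / ((1 + s\<^sup>2) * (1 + t\<^sup>2)) * norm b"
          using C[OF A, of t s] by (intro mult_right_mono) auto
        finally show ?thesis by simp
      qed
      then show ?thesis by blast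
    qed
    have cont: "continuous_on A (\<lambda>p. U c (f p) (g p))" if "continuous_on A f" "continuous_on A g" for c f g and A :: "'c::topological_space set"
      unfolding U_def
      by (intro continuous_intros continuous_on_compose2[OF schwartz_continuous[OF u, of UNIV]] that) auto
    have line: "(\<integral>t. U c s t \<partial>lborel) = 0" for c s
    proof -
      have "integrable lborel (\<lambda>t. u (x + s *\<^sub>R \<eta> + t *\<^sub>R (\<xi> + c *\<^sub>R \<eta>)))"
        using line_moment_integrable[OF u noncollinear_nonzero[OF noncollinear_shear[OF nc]], of 0] by simp
      then have "(\<integral>t. u (x + s *\<^sub>R \<eta> + t *\<^sub>R (\<xi> + c *\<^sub>R \<eta>)) \<bullet> b \<partial>lborel) = line_moment 0 u (x + s *\<^sub>R \<eta>) (\<xi> + c *\<^sub>R \<eta>) \<bullet> b"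
        by (simp add: line_moment_def)
      then show ?thesis by (simp add: U_def zero)
    qed
    have iexp_cont: "continuous_on A (\<lambda>p. iexp (f p))" if "continuous_on A f" for f and A :: "'c::topological_space set"
      by (intro continuous_intros that)
    \<comment> \<open>The partial Fourier transform in \<open>s\<close>.\<close>
    define V where "V \<sigma> t = (CLINT s|lborel. iexp (\<sigma> * s) * U 0 s t)" for \<sigma> t
    obtain C where C: "\<And>s t. norm (U 0 s t) \<le> C / ((1 + s\<^sup>2) * (1 + t\<^sup>2))"
      using bound[of 0] by blast
    have C0: "C \<ge> 0" using order_trans[OF norm_ge_zero C[of 0 0]] by simp
    have pos: "0 < 1 + a\<^sup>2" for a :: real by (simp add: add_pos_nonneg)
    have C1: "norm (iexp a * U 0 s t) \<le> C / (1 + s\<^sup>2)" for a s t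
    proof -
      have "C / ((1 + s\<^sup>2) * (1 + t\<^sup>2)) \<le> C / (1 + s\<^sup>2)"
        using C0 pos[of s] pos[of t] by (intro divide_left_mono) auto
      then show ?thesis using C[of s t] by (simp add: norm_mult)
    qed
    have V_cont_t: "continuous_on UNIV (V \<sigma>)" for \<sigma>
      unfolding V_def
      by (rule continuous_integral_dominated[OF _ _ C1 integrable_const_over_1_plus_square])
        (auto intro!: continuous_on_mult cont iexp_cont borel_measurable_continuous_onI continuous_intros simp del: of_real_mult)
    have V_cont_\<sigma>: "continuous_on UNIV (\<lambda>\<sigma>. V \<sigma> t)" for t
      unfolding V_def
      by (rule continuous_integral_dominated[OF _ _ C1 integrable_const_over_1_plus_square])
        (auto intro!: continuous_on_mult cont iexp_cont borel_measurable_continuous_onI continuous_intros simp del: of_real_mult)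
    have int_s: "integrable lborel (\<lambda>s. iexp (\<sigma> * s) * U 0 s t)" for \<sigma> t
    proof (rule Bochner_Integration.integrable_bound[OF integrable_const_over_1_plus_square[of C]])
      show "(\<lambda>s. iexp (\<sigma> * s) * U 0 s t) \<in> borel_measurable lborel"
        by (intro continuous_borel_measurable_lborel continuous_on_mult cont iexp_cont continuous_intros)
      show "AE s in lborel. norm (iexp (\<sigma> * s) * U 0 s t) \<le> norm (C / (1 + s\<^sup>2))"
        using order_trans[OF C1 abs_ge_self] by (intro AE_I2) (simp only: real_norm_def)
    qed
    define K where "K = (\<integral>s. C / (1 + s\<^sup>2) \<partial>lborel)"
    have V_bound: "norm (V \<sigma> t) \<le> K / (1 + t\<^sup>2)" for \<sigma> t
    proof -
      have "norm (V \<sigma> t) \<le> (\<integral>s. C / (1 + s\<^sup>2) / (1 + t\<^sup>2) \<partial>lborel)"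
        unfolding V_def
      proof (rule Bochner_Integration.integral_norm_bound_integral[OF int_s])
        show "integrable lborel (\<lambda>s. C / (1 + s\<^sup>2) / (1 + t\<^sup>2))"
          by (rule integrable_divide[OF integrable_const_over_1_plus_square])
        show "norm (iexp (\<sigma> * s) * U 0 s t) \<le> C / (1 + s\<^sup>2) / (1 + t\<^sup>2)" for s
          using C[of s t] by (simp add: norm_mult)
      qed
      also have "\<dots> = K / (1 + t\<^sup>2)" unfolding K_def by (rule integral_divide_zero)
      finally show ?thesis .
    qed
    have V_int: "integrable lborel (V \<sigma>)" for \<sigma>
    proof (rule Bochner_Integration.integrable_bound[OF integrable_const_over_1_plus_square[of K]])
      show "V \<sigma> \<in> borel_measurable lborel"
        by (rule continuous_borel_measurable_lborel[OF V_cont_t])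
      show "AE t in lborel. norm (V \<sigma> t) \<le> norm (K / (1 + t\<^sup>2))"
        using order_trans[OF V_bound abs_ge_self] by (intro AE_I2) (simp only: real_norm_def)
    qed
    \<comment> \<open>The slice theorem: Fubini and the substitution \<open>s \<mapsto> s - c t\<close>.\<close>
    have slice: "(CLINT t|lborel. iexp (- (\<sigma> * c) * t) * V \<sigma> t) = 0" for \<sigma> c
    proof -
      obtain D where D: "\<And>s t. norm (U c s t) \<le> D / ((1 + s\<^sup>2) * (1 + t\<^sup>2))"
        using bound[of c] by blast
      have int: "integrable (lborel \<Otimes>\<^sub>M lborel) (\<lambda>(s, t). iexp (\<sigma> * s) * U c s t)"
      proof (rule integrable_plane_if_bounded)
        show "continuous_on UNIV (\<lambda>(s, t). iexp (\<sigma> * s) * U c s t)"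
          unfolding case_prod_beta by (intro continuous_on_mult iexp_cont cont continuous_intros)
        show "norm (case (s, t) of (s, t) \<Rightarrow> iexp (\<sigma> * s) * U c s t) \<le> D / ((1 + s\<^sup>2) * (1 + t\<^sup>2))" for s t
          using D by (simp add: norm_mult)
      qed
      have "(CLINT s|lborel. iexp (\<sigma> * s) * U c s t) = iexp (- (\<sigma> * c) * t) * V \<sigma> t" for t
      proof -
        have "(CLINT s|lborel. iexp (\<sigma> * s) * U c s t) = (CLINT s|lborel. iexp (\<sigma> * (- (c * t) + 1 * s)) * U c (- (c * t) + 1 * s) t)"
          by (subst lborel_integral_real_affine[where c = 1 and t = "- (c * t)"]) simp_all
        also have "\<dots> = (CLINT s|lborel. iexp (- (\<sigma> * c) * t) * (iexp (\<sigma> * s) * U 0 s t))"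
        proof (rule Bochner_Integration.integral_cong[OF refl])
          fix s
          have "iexp (\<sigma> * (- (c * t) + 1 * s)) = iexp (- (\<sigma> * c) * t) * iexp (\<sigma> * s)"
            by (simp add: exp_add[symmetric] algebra_simps)
          moreover have "U c (- (c * t) + 1 * s) t = U 0 s t"
            by (subst shear) simp
          ultimately show "iexp (\<sigma> * (- (c * t) + 1 * s)) * U c (- (c * t) + 1 * s) t = iexp (- (\<sigma> * c) * t) * (iexp (\<sigma> * s) * U 0 s t)"
            by (simp only: mult.assoc)
        qed
        finally show ?thesis unfolding V_def by (simp only: integral_mult_right_zero)
      qed
      then have "(CLINT t|lborel. iexp (- (\<sigma> * c) * t) * V \<sigma> t) = (CLINT t|lborel. CLINT s|lborel. iexp (\<sigma> * s) * U c s t)"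
        by simp
      also have "\<dots> = (CLINT s|lborel. CLINT t|lborel. iexp (\<sigma> * s) * U c s t)"
        by (rule lborel_pair.Fubini_integral[OF int])
      also have "\<dots> = 0" by (simp only: integral_mult_right_zero line mult_zero_right integral_zero)
      finally show ?thesis .
    qed
    have V_zero: "V \<sigma> t = 0" if "\<sigma> \<noteq> 0" for \<sigma> t
    proof (rule fourier_uniqueness_complex[OF V_cont_t V_int])
      fix \<tau>
      have "- (\<sigma> * (- \<tau> / \<sigma>)) = \<tau>" using that by simp
      then show "(CLINT t|lborel. iexp (\<tau> * t) * V \<sigma> t) = 0"
        using slice[of \<sigma> "- \<tau> / \<sigma>"] by (simp only:)
    qed
    have "V \<sigma> t = 0" for \<sigma> t
    proof (cases "\<sigma> = 0")
      case True
      have "((\<lambda>\<sigma>. V \<sigma> t) \<longlongrightarrow> V 0 t) (at 0)"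
        using V_cont_\<sigma>[of t] by (simp add: continuous_on_def)
      moreover have "((\<lambda>\<sigma>. V \<sigma> t) \<longlongrightarrow> 0) (at 0)"
        by (rule tendsto_eventually) (simp add: V_zero eventually_at_filter)
      ultimately show ?thesis using True tendsto_unique[OF at_neq_bot] by blast
    qed (rule V_zero)
    then have "U 0 0 0 = 0"
    proof (intro fourier_uniqueness_complex[of "\<lambda>s. U 0 s 0"])
      show "integrable lborel (\<lambda>s. U 0 s 0)" using int_s[of 0 0] by simp
    qed (auto simp: V_def intro!: cont continuous_intros simp del: of_real_mult)
    then show ?thesis by (simp add: U_def)
  qed
  then show ?thesis by (metis inner_eq_zero_iff)
qed

section \<open>Polarization\<close>

lemma sum_lists_over_Suc:
  "(\<Sum>ps | set ps \<subseteq> S \<and> length ps = Suc N. F ps) = (\<Sum>p\<in>S. \<Sum>ps | set ps \<subseteq> S \<and> length ps = N. F (p # ps))"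
  if "finite S"
proof -
  have "(\<Sum>ps | set ps \<subseteq> S \<and> length ps = Suc N. F ps) = (\<Sum>(p, ps)\<in>S \<times> {ps. set ps \<subseteq> S \<and> length ps = N}. F (p # ps))"
    by (rule sum.reindex_bij_witness[of _ "\<lambda>(p, ps). p # ps" "\<lambda>ps. (hd ps, tl ps)"])
      (auto simp: length_Suc_conv)
  then show ?thesis by (simp add: sum.cartesian_product)
qed

text \<open>
  Multilinear expansion: each slot independently selects one of the unit vectors that make up \<open>v\<close>.
\<close>

lemma sum_weight_of_sum_axis:
  fixes G :: "'n::finite list \<Rightarrow> 'a::real_vector"
  assumes S: "finite S" and v: "v = (\<Sum>p\<in>S. axis (c p) 1)"
  shows "(\<Sum>is | length is = N. weight v is *\<^sub>R G is) = (\<Sum>ps | set ps \<subseteq> S \<and> length ps = N. G (map c ps))"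
proof (induction N arbitrary: G)
  case 0
  have "{ps. set ps \<subseteq> S \<and> ps = []} = {[]}" by auto
  then show ?case by simp
next
  case (Suc N)
  have "(\<Sum>is | length is = Suc N. weight v is *\<^sub>R G is) = (\<Sum>a\<in>UNIV. v $ a *\<^sub>R (\<Sum>is | length is = N. weight v is *\<^sub>R G (a # is)))"
    by (simp add: sum_lists_Suc scaleR_sum_right)
  also have "\<dots> = (\<Sum>a\<in>UNIV. \<Sum>p\<in>S. if a = c p then \<Sum>is | length is = N. weight v is *\<^sub>R G (a # is) else 0)"
    by (intro sum.cong refl) (auto simp: v scaleR_sum_left axis_def if_distrib[of "\<lambda>r. r *\<^sub>R _"] cong: if_cong intro!: sum.cong)
  also have "\<dots> = (\<Sum>p\<in>S. \<Sum>is | length is = N. weight v is *\<^sub>R G (c p # is))"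
    by (subst sum.swap) simp
  also have "\<dots> = (\<Sum>p\<in>S. \<Sum>ps | set ps \<subseteq> S \<and> length ps = N. G (map c (p # ps)))"
    unfolding Suc.IH by simp
  also have "\<dots> = (\<Sum>ps | set ps \<subseteq> S \<and> length ps = Suc N. G (map c ps))"
    by (rule sum_lists_over_Suc[OF S, symmetric])
  finally show ?case .
qed

lemma alternating_sum_supersets:
  assumes "finite A" "T \<subseteq> A"
  shows "(\<Sum>S | T \<subseteq> S \<and> S \<subseteq> A. (- 1) ^ card S) = (if T = A then (- 1) ^ card A else (0::real))"
proof (cases "T = A")
  case True
  then have "{S. T \<subseteq> S \<and> S \<subseteq> A} = {A}" by auto
  with True show ?thesis by simp
next
  case False
  with assms have "card {S. S \<subseteq> A \<and> T \<subseteq> S \<and> even (card S)} = card {S. S \<subseteq> A \<and> T \<subseteq> S \<and> odd (card S)}"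
    by (intro card_subsupersets_even_odd) auto
  then have "(\<Sum>S | S \<subseteq> A \<and> T \<subseteq> S. (- 1) ^ card S) = (0::real)"
    using assms(1) by (intro sum_alternating_cancels) (auto simp: conj_ac)
  with False show ?thesis by (simp add: conj_commute)
qed

text \<open>
  A list of length \<open>N\<close> that contains all of \<open>0, \<dots>, N - 1\<close> is the list of values of a permutation.
\<close>

lemma sum_permuted_lists:
  "(\<Sum>\<pi> | \<pi> permutes {..<N}. H (map \<pi> [0..<N])) = (\<Sum>ps | set ps = {..<N} \<and> length ps = N. H ps)"
proof (rule sum.reindex_bij_witness[of _ "\<lambda>ps i. if i < N then ps ! i else i" "\<lambda>\<pi>. map \<pi> [0..<N]"])
  fix \<pi> assume "\<pi> \<in> {\<pi>. \<pi> permutes {..<N}}"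
  then have \<pi>: "\<pi> permutes {..<N}" by simp
  show "(\<lambda>i. if i < N then map \<pi> [0..<N] ! i else i) = \<pi>"
    using permutes_not_in[OF \<pi>] by (auto simp: fun_eq_iff)
  show "map \<pi> [0..<N] \<in> {ps. set ps = {..<N} \<and> length ps = N}"
    using permutes_image[OF \<pi>] by (simp add: atLeast0LessThan)
next
  fix ps assume "ps \<in> {ps. set ps = {..<N} \<and> length ps = N}"
  then have ps: "set ps = {..<N}" "length ps = N" by auto
  show "map (\<lambda>i. if i < N then ps ! i else i) [0..<N] = ps"
    using ps by (intro nth_equalityI) auto
  have "distinct ps" using ps by (simp add: card_distinct)
  then have "bij_betw (\<lambda>i. ps ! i) {..<N} {..<N}"
    using ps by (intro bij_betw_nth) auto
  then have "bij_betw (\<lambda>i. if i < N then ps ! i else i) {..<N} {..<N}"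
    by (rule bij_betw_cong[THEN iffD1, rotated]) simp
  then show "(\<lambda>i. if i < N then ps ! i else i) \<in> {\<pi>. \<pi> permutes {..<N}}"
    by (intro CollectI bij_imp_permutes) auto
qed auto

lemma sum_weight_symmetrize:
  fixes G :: "'n::finite list \<Rightarrow> 'a::real_vector"
  shows "(\<Sum>is | length is = N. weight v is *\<^sub>R symmetrize G is) = (\<Sum>is | length is = N. weight v is *\<^sub>R G is)"
proof -
  have weight_perm: "weight v (permute_list \<pi> is) = weight v is" if "\<pi> permutes {..<length is}" for \<pi> "is"
    unfolding weight_def by (metis mset_map mset_permute_list[OF that] prod_mset_prod_list)
  have perm: "(\<Sum>is | length is = N. weight v is *\<^sub>R G (permute_list \<pi> is)) = (\<Sum>is | length is = N. weight v is *\<^sub>R G is)"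
    if \<pi>: "\<pi> permutes {..<N}" for \<pi>
  proof (rule sum.reindex_bij_witness[of _ "permute_list (inv \<pi>)" "permute_list \<pi>"])
    note inv = permutes_inv[OF \<pi>]
    fix "is" assume "is \<in> {is :: 'n list. length is = N}"
    then have l: "length is = N" by simp
    show "permute_list (inv \<pi>) (permute_list \<pi> is) = is" "permute_list \<pi> (permute_list (inv \<pi>) is) = is"
      using permute_list_compose[of "inv \<pi>" "is" \<pi>] permute_list_compose[of \<pi> "is" "inv \<pi>"] \<pi> inv l permutes_inv_o[OF \<pi>] by simp_all
    show "weight v (permute_list \<pi> is) *\<^sub>R G (permute_list \<pi> is) = weight v is *\<^sub>R G (permute_list \<pi> is)"
      using weight_perm[of \<pi> "is"] \<pi> l by simp
  qed simp_all
  have "(\<Sum>is | length is = N. weight v is *\<^sub>R symmetrize G is) =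
    (\<Sum>is | length is = N. (1 / fact N) *\<^sub>R (\<Sum>\<pi> | \<pi> permutes {..<N}. weight v is *\<^sub>R G (permute_list \<pi> is)))"
    by (intro sum.cong refl) (simp add: symmetrize_def scaleR_sum_right)
  also have "\<dots> = (1 / fact N) *\<^sub>R (\<Sum>\<pi> | \<pi> permutes {..<N}. \<Sum>is | length is = N. weight v is *\<^sub>R G (permute_list \<pi> is))"
    by (subst sum.swap) (simp add: scaleR_sum_right)
  also have "\<dots> = (1 / fact N) *\<^sub>R (\<Sum>\<pi> | \<pi> permutes {..<N}. \<Sum>is | length is = N. weight v is *\<^sub>R G is)"
    by (simp add: perm)
  also have "\<dots> = (\<Sum>is | length is = N. weight v is *\<^sub>R G is)"
    by (simp add: sum_constant_scaleR card_permutations[of _ N])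
  finally show ?thesis .
qed

text \<open>
  Evaluate the form at sums of the unit vectors \<open>e(a\<^sub>p)\<close> for \<open>p\<close> in a set \<open>S\<close> of positions and take the
  alternating sum over \<open>S\<close>. By inclusion and exclusion only those selections survive in which every
  position is chosen, that is, the permutations, and these sum up to the symmetrization. Selecting by
  positions instead of values accounts for repeated indices.
\<close>

lemma polarization:
  fixes G :: "'n::finite list \<Rightarrow> 'a::real_vector"
  shows "(\<forall>v. (\<Sum>is | length is = N. weight v is *\<^sub>R G is) = 0) \<longleftrightarrow> (\<forall>is. length is = N \<longrightarrow> symmetrize G is = 0)"
proof (intro iffI allI impI)
  fix as :: "'n list"
  assume zero: "\<forall>v. (\<Sum>is | length is = N. weight v is *\<^sub>R G is) = 0" and as: "length as = N"
  \<comment> \<open>Lists of positions in \<open>as\<close>, one position for each slot of \<open>G\<close>.\<close>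
  let ?L = "{ps. set ps \<subseteq> {..<N} \<and> length ps = N}"
  have fin: "finite ?L" using finite_lists_length_eq[of "{..<N}" N] by simp
  have "0 = (\<Sum>S\<in>Pow {..<N}. (- 1) ^ card S *\<^sub>R (\<Sum>ps | set ps \<subseteq> S \<and> length ps = N. G (map ((!) as) ps)))"
  proof (rule sum.neutral[symmetric], intro ballI)
    fix S assume "S \<in> Pow {..<N}"
    then have "finite S" using finite_subset by blast
    from sum_weight_of_sum_axis[OF this refl, where c = "(!) as" and N = N and G = G] zero
    show "(- 1) ^ card S *\<^sub>R (\<Sum>ps | set ps \<subseteq> S \<and> length ps = N. G (map ((!) as) ps)) = 0"
      by simp
  qed
  also have "\<dots> = (\<Sum>S\<in>Pow {..<N}. \<Sum>ps\<in>?L. if set ps \<subseteq> S then (- 1) ^ card S *\<^sub>R G (map ((!) as) ps) else 0)"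
  proof (rule sum.cong[OF refl])
    fix S assume S: "S \<in> Pow {..<N}"
    have "(\<Sum>ps | set ps \<subseteq> S \<and> length ps = N. (- 1) ^ card S *\<^sub>R G (map ((!) as) ps)) =
        (\<Sum>ps\<in>{ps \<in> ?L. set ps \<subseteq> S}. (- 1) ^ card S *\<^sub>R G (map ((!) as) ps))"
      using S by (intro sum.cong) auto
    then show "(- 1) ^ card S *\<^sub>R (\<Sum>ps | set ps \<subseteq> S \<and> length ps = N. G (map ((!) as) ps)) =
        (\<Sum>ps\<in>?L. if set ps \<subseteq> S then (- 1) ^ card S *\<^sub>R G (map ((!) as) ps) else 0)"
      unfolding scaleR_sum_right by (simp only: sum.inter_filter[OF fin])
  qed
  also have "\<dots> = (\<Sum>ps\<in>?L. \<Sum>S\<in>Pow {..<N}. if set ps \<subseteq> S then (- 1) ^ card S *\<^sub>R G (map ((!) as) ps) else 0)"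
    by (rule sum.swap)
  also have "\<dots> = (\<Sum>ps\<in>?L. (\<Sum>S | set ps \<subseteq> S \<and> S \<subseteq> {..<N}. (- 1) ^ card S) *\<^sub>R G (map ((!) as) ps))"
  proof (rule sum.cong[OF refl])
    fix ps
    have "{S \<in> Pow {..<N}. set ps \<subseteq> S} = {S. set ps \<subseteq> S \<and> S \<subseteq> {..<N}}" by auto
    then show "(\<Sum>S\<in>Pow {..<N}. if set ps \<subseteq> S then (- 1) ^ card S *\<^sub>R G (map ((!) as) ps) else 0) =
        (\<Sum>S | set ps \<subseteq> S \<and> S \<subseteq> {..<N}. (- 1) ^ card S) *\<^sub>R G (map ((!) as) ps)"
      by (simp add: scaleR_sum_left sum.inter_filter[symmetric])
  qed
  also have "\<dots> = (\<Sum>ps\<in>?L. if set ps = {..<N} then (- 1) ^ N *\<^sub>R G (map ((!) as) ps) else 0)"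
    by (intro sum.cong refl) (auto simp: alternating_sum_supersets)
  also have "\<dots> = (\<Sum>ps\<in>{ps \<in> ?L. set ps = {..<N}}. (- 1) ^ N *\<^sub>R G (map ((!) as) ps))"
    by (rule sum.inter_filter[OF fin, symmetric])
  also have "{ps \<in> ?L. set ps = {..<N}} = {ps. set ps = {..<N} \<and> length ps = N}" by auto
  also have "(\<Sum>ps | set ps = {..<N} \<and> length ps = N. (- 1) ^ N *\<^sub>R G (map ((!) as) ps)) =
     (- 1) ^ N *\<^sub>R (\<Sum>\<pi> | \<pi> permutes {..<N}. G (map ((!) as) (map \<pi> [0..<N])))"
    using sum_permuted_lists[where H = "\<lambda>ps. G (map ((!) as) ps)" and N = N] by (simp add: scaleR_sum_right)
  also have "(\<Sum>\<pi> | \<pi> permutes {..<N}. G (map ((!) as) (map \<pi> [0..<N]))) = fact N *\<^sub>R symmetrize G as"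
    using as by (simp add: symmetrize_def permute_list_def o_def)
  finally show "symmetrize G as = 0" by simp
next
  fix v
  assume "\<forall>is. length is = N \<longrightarrow> symmetrize G is = 0"
  then have "(\<Sum>is | length is = N. weight v is *\<^sub>R symmetrize G is) = 0" by simp
  then show "(\<Sum>is | length is = N. weight v is *\<^sub>R G is) = 0" by (simp add: sum_weight_symmetrize)
qed

lemma symmetrize_sum_scaleR:
  "symmetrize (\<lambda>is. \<Sum>j\<in>J. c j *\<^sub>R G j is) as = (\<Sum>j\<in>J. c j *\<^sub>R symmetrize (G j) as)"
  unfolding symmetrize_def scaleR_sum_right
  by (subst sum.swap) (simp add: mult.commute)

lemma bipolarization:
  fixes G :: "'n::finite list \<Rightarrow> 'n list \<Rightarrow> 'a::real_vector"
  shows "(\<forall>\<eta> \<xi>. (\<Sum>ps | length ps = M. \<Sum>rs | length rs = N. (weight \<eta> ps * weight \<xi> rs) *\<^sub>R G ps rs) = 0) \<longleftrightarrow>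
    (\<forall>ps rs. length ps = M \<longrightarrow> length rs = N \<longrightarrow> symmetrize (\<lambda>ps'. symmetrize (G ps') rs) ps = 0)"
proof -
  have "(\<Sum>ps | length ps = M. \<Sum>rs | length rs = N. (weight \<eta> ps * weight \<xi> rs) *\<^sub>R G ps rs) =
      (\<Sum>rs | length rs = N. weight \<xi> rs *\<^sub>R (\<Sum>ps | length ps = M. weight \<eta> ps *\<^sub>R G ps rs))" for \<eta> \<xi>
    by (subst sum.swap) (simp add: scaleR_sum_right mult.commute)
  then have "(\<forall>\<eta> \<xi>. (\<Sum>ps | length ps = M. \<Sum>rs | length rs = N. (weight \<eta> ps * weight \<xi> rs) *\<^sub>R G ps rs) = 0) \<longleftrightarrow>
      (\<forall>\<eta> rs. length rs = N \<longrightarrow> symmetrize (\<lambda>rs. \<Sum>ps | length ps = M. weight \<eta> ps *\<^sub>R G ps rs) rs = 0)"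
    by (simp only: polarization)
  also have "\<dots> \<longleftrightarrow> (\<forall>rs. length rs = N \<longrightarrow> (\<forall>\<eta>. (\<Sum>ps | length ps = M. weight \<eta> ps *\<^sub>R symmetrize (G ps) rs) = 0))"
    unfolding symmetrize_sum_scaleR by blast
  also have "\<dots> \<longleftrightarrow> (\<forall>ps rs. length ps = M \<longrightarrow> length rs = N \<longrightarrow> symmetrize (\<lambda>ps'. symmetrize (G ps') rs) ps = 0)"
    unfolding polarization by blast
  finally show ?thesis .
qed

section \<open>The Saint Venant operator as an iterated plane curl\<close>

lemma partials_sum:
  assumes "\<And>i. i \<in> I \<Longrightarrow> smooth (u i)"
  shows "partials is (\<lambda>x. \<Sum>i\<in>I. c i *\<^sub>R u i x) = (\<lambda>x. \<Sum>i\<in>I. c i *\<^sub>R partials is (u i) x)"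
proof (induction "is")
  case (Cons a "is")
  have "partial a (\<lambda>x. \<Sum>i\<in>I. c i *\<^sub>R partials is (u i) x) = (\<lambda>x. \<Sum>i\<in>I. c i *\<^sub>R partial a (partials is (u i)) x)"
    unfolding partial_def dirderiv_def[symmetric]
    by (intro ext dirderiv_sum smooth_partials assms)
  then show ?case by (simp add: Cons)
qed simp

lemma funpow_compose_on:
  assumes "\<And>f. f \<in> S \<Longrightarrow> F f \<in> S" "\<And>f. f \<in> S \<Longrightarrow> G f \<in> S"
    and "\<And>f. f \<in> S \<Longrightarrow> F (G f) = G (F f)" and "f \<in> S"
  shows "((\<lambda>f. F (G f)) ^^ j) f = (F ^^ j) ((G ^^ j) f)"
proof (induction j)
  case (Suc j)
  have "G ((F ^^ j) ((G ^^ j) f)) = (F ^^ j) (G ((G ^^ j) f))"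
    using funpow_commute_on[of S G F "(G ^^ j) f" 1 j] assms funpow_closed[of S G f j] by simp
  with Suc show ?case by simp
qed simp

lemma tensor_dirderiv_power_closed:
  "f \<in> symmetric_schwartz \<Longrightarrow> (tensor_dirderiv v ^^ m) f \<in> symmetric_schwartz"
  by (rule funpow_closed) (rule tensor_dirderiv_closed)

lemma contract_power_contract_power:
  "f \<in> symmetric_schwartz \<Longrightarrow> (contract v ^^ i) ((contract w ^^ j) f) = (contract w ^^ j) ((contract v ^^ i) f)"
  by (rule funpow_commute_on[where S = symmetric_schwartz])
    (simp_all add: contract_closed contract_commute)

lemma contract_power_tensor_dirderiv_power:
  "f \<in> symmetric_schwartz \<Longrightarrow>
    (contract v ^^ i) ((tensor_dirderiv w ^^ j) f) = (tensor_dirderiv w ^^ j) ((contract v ^^ i) f)"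
  by (rule funpow_commute_on[where S = symmetric_schwartz])
    (simp_all add: contract_closed tensor_dirderiv_closed tensor_dirderiv_contract)

text \<open>
  The binomial theorem for \<open>(A - B)\<^sup>r\<close>, where \<open>A = \<partial>\<^sub>\<xi> \<circ> contract \<eta>\<close> and \<open>B = \<partial>\<^sub>\<eta> \<circ> contract \<xi>\<close>
  commute on symmetric fields.
\<close>

lemma plane_curl_power_binomial:
  fixes f :: "('n::finite, 'a::euclidean_space) tensor_field"
  assumes f: "f \<in> symmetric_schwartz"
  shows "(plane_curl \<eta> \<xi> ^^ r) f is x = (\<Sum>l\<le>r. ((- 1) ^ l * real (r choose l)) *\<^sub>R
     (tensor_dirderiv \<eta> ^^ l) ((contract \<xi> ^^ l) ((tensor_dirderiv \<xi> ^^ (r - l)) ((contract \<eta> ^^ (r - l)) f))) is x)"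
proof -
  define A where "A = (\<lambda>f :: ('n, 'a) tensor_field. tensor_dirderiv \<xi> (contract \<eta> f))"
  define B where "B = (\<lambda>f :: ('n, 'a) tensor_field. tensor_dirderiv \<eta> (contract \<xi> f))"
  have closed: "A g \<in> symmetric_schwartz" "B g \<in> symmetric_schwartz" if "g \<in> symmetric_schwartz" for g
    using that by (simp_all add: A_def B_def tensor_dirderiv_closed contract_closed)
  have AB: "A (B g) = B (A g)" if g: "g \<in> symmetric_schwartz" for g
    using g unfolding A_def B_def
    by (simp add: tensor_dirderiv_contract[symmetric] tensor_dirderiv_closed contract_closed
        contract_commute[OF g, of \<eta> \<xi>] tensor_dirderiv_commute[of _ \<xi> \<eta>])
  have A_diff: "A (\<lambda>is x. g is x - h is x) = (\<lambda>is x. A g is x - A h is x)"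
    and B_diff: "B (\<lambda>is x. g is x - h is x) = (\<lambda>is x. B g is x - B h is x)"
    if "g \<in> symmetric_schwartz" "h \<in> symmetric_schwartz" for g h
    using that unfolding A_def B_def contract_diff by (simp_all add: tensor_dirderiv_diff contract_closed)
  have pow_closed: "(A ^^ j) g \<in> symmetric_schwartz" "(B ^^ j) g \<in> symmetric_schwartz" if "g \<in> symmetric_schwartz" for g j
    using that closed by (auto intro: funpow_closed)
  have A_pow_diff: "(A ^^ j) (\<lambda>is x. g is x - h is x) = (\<lambda>is x. (A ^^ j) g is x - (A ^^ j) h is x)"
    if "g \<in> symmetric_schwartz" "h \<in> symmetric_schwartz" for g h j
    by (induction j) (simp_all add: A_diff pow_closed that)
  have B_pow_diff: "(B ^^ j) (\<lambda>is x. g is x - h is x) = (\<lambda>is x. (B ^^ j) g is x - (B ^^ j) h is x)"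
    if "g \<in> symmetric_schwartz" "h \<in> symmetric_schwartz" for g h j
    by (induction j) (simp_all add: B_diff pow_closed that)
  have "(plane_curl \<eta> \<xi> ^^ r) g is x = (\<Sum>l\<le>r. ((- 1) ^ l * real (r choose l)) *\<^sub>R (B ^^ l) ((A ^^ (r - l)) g) is x)"
    if "g \<in> symmetric_schwartz" for g
    using that
  proof (induction r arbitrary: g)
    case (Suc r)
    note g = \<open>g \<in> symmetric_schwartz\<close>
    define E where "E i j = (B ^^ i) ((A ^^ j) g) is x" for i j
    have curl: "plane_curl \<eta> \<xi> g = (\<lambda>is x. A g is x - B g is x)"
      by (simp add: plane_curl_def A_def B_def)
    \<comment> \<open>The recursion behind Pascal's triangle.\<close>
    have step: "(B ^^ l) ((A ^^ j) (plane_curl \<eta> \<xi> g)) is x = E l (Suc j) - E (Suc l) j" for l j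
    proof -
      have "(A ^^ j) (B g) = B ((A ^^ j) g)"
        using funpow_commute_on[of symmetric_schwartz A B g j 1] closed AB g by simp
      then show ?thesis
        unfolding curl E_def
        by (simp add: A_pow_diff B_pow_diff closed pow_closed g funpow_swap1)
    qed
    have "(plane_curl \<eta> \<xi> ^^ Suc r) g is x = (plane_curl \<eta> \<xi> ^^ r) (plane_curl \<eta> \<xi> g) is x"
      by (simp only: funpow_Suc_right o_apply)
    also have "\<dots> = (\<Sum>l\<le>r. ((- 1) ^ l * real (r choose l)) *\<^sub>R (E l (Suc (r - l)) - E (Suc l) (r - l)))"
      by (subst Suc.IH[OF plane_curl_closed[OF g]]) (simp only: step)
    also have "\<dots> = (\<Sum>l\<le>r. ((- 1) ^ l * real (r choose l)) *\<^sub>R E l (Suc r - l)) + (\<Sum>l\<le>r. ((- 1) ^ Suc l * real (r choose l)) *\<^sub>R E (Suc l) (Suc r - Suc l))"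
      by (simp add: scaleR_diff_right sum_subtractf sum_negf Suc_diff_le)
    also have "(\<Sum>l\<le>r. ((- 1) ^ l * real (r choose l)) *\<^sub>R E l (Suc r - l)) = (\<Sum>l\<le>Suc r. ((- 1) ^ l * real (r choose l)) *\<^sub>R E l (Suc r - l))"
      by simp
    also have "\<dots> = E 0 (Suc r) + (\<Sum>l\<le>r. ((- 1) ^ Suc l * real (r choose Suc l)) *\<^sub>R E (Suc l) (Suc r - Suc l))"
      by (subst sum.atMost_Suc_shift) simp
    finally have "(plane_curl \<eta> \<xi> ^^ Suc r) g is x = E 0 (Suc r) + (\<Sum>l\<le>r. ((- 1) ^ Suc l * real (Suc r choose Suc l)) *\<^sub>R E (Suc l) (Suc r - Suc l))"
      by (simp add: sum.distrib[symmetric] scaleR_add_left[symmetric] algebra_simps)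
    also have "\<dots> = (\<Sum>l\<le>Suc r. ((- 1) ^ l * real (Suc r choose l)) *\<^sub>R E l (Suc r - l))"
      by (subst sum.atMost_Suc_shift) simp
    finally show ?case by (simp only: E_def)
  qed simp
  moreover have "(A ^^ j) g = (tensor_dirderiv \<xi> ^^ j) ((contract \<eta> ^^ j) g)" "(B ^^ j) g = (tensor_dirderiv \<eta> ^^ j) ((contract \<xi> ^^ j) g)"
    if "g \<in> symmetric_schwartz" for g j
    unfolding A_def B_def
    by (intro funpow_compose_on[where S = symmetric_schwartz] tensor_dirderiv_closed contract_closed tensor_dirderiv_contract that; assumption)+
  ultimately show ?thesis
    by (simp add: f contract_power_closed tensor_dirderiv_power_closed)
qed

text \<open>
  The order of the operators on the left is chosen so that expanding them from the outside in
  produces the sums in the order in which index lists are split on the right.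
\<close>

lemma partials_contraction:
  assumes f: "f \<in> symmetric_schwartz"
  shows "(contract \<eta> ^^ j) ((tensor_dirderiv \<eta> ^^ l) ((contract \<xi> ^^ l) ((tensor_dirderiv \<xi> ^^ j) ((contract \<xi> ^^ k) f)))) [] x =
    (\<Sum>ps1 | length ps1 = j. \<Sum>ps2 | length ps2 = l. \<Sum>qs1 | length qs1 = l. \<Sum>qs2 | length qs2 = j. \<Sum>is | length is = k.
      (weight \<eta> (ps1 @ ps2) * weight \<xi> ((qs1 @ qs2) @ is)) *\<^sub>R partials (ps2 @ qs2) (f (is @ ps1 @ qs1)) x)"
proof -
  define g where "g = (contract \<xi> ^^ k) f"
  define T where "T = (tensor_dirderiv \<xi> ^^ j) g"
  define h where "h = (contract \<xi> ^^ l) T"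
  have closed: "g \<in> symmetric_schwartz" "T \<in> symmetric_schwartz" "h \<in> symmetric_schwartz"
    by (auto simp: g_def T_def h_def intro!: contract_power_closed tensor_dirderiv_power_closed f)
  have sm: "smooth (u js)" if "u \<in> symmetric_schwartz" for u js
    by (intro schwartz_smooth symmetric_schwartzD(2) that)
  have "g js = (\<lambda>y. \<Sum>is | length is = k. weight \<xi> is *\<^sub>R f (is @ js) y)" for js
    by (simp add: g_def contract_power fun_eq_iff)
  then have g: "partials L (g js) = (\<lambda>y. \<Sum>is | length is = k. weight \<xi> is *\<^sub>R partials L (f (is @ js)) y)" for L js
    by (simp add: partials_sum sm f)
  have "T js = (\<lambda>y. \<Sum>qs | length qs = j. weight \<xi> qs *\<^sub>R partials qs (g js) y)" for js
    by (simp add: T_def tensor_dirderiv_power closed fun_eq_iff)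
  then have T: "partials L (T js) = (\<lambda>y. \<Sum>qs | length qs = j. weight \<xi> qs *\<^sub>R partials (L @ qs) (g js) y)" for L js
    by (simp add: partials_sum sm closed smooth_partials partials_append)
  have "h js = (\<lambda>y. \<Sum>qs | length qs = l. weight \<xi> qs *\<^sub>R T (qs @ js) y)" for js
    by (simp add: h_def contract_power fun_eq_iff)
  then have h: "partials L (h js) = (\<lambda>y. \<Sum>qs | length qs = l. weight \<xi> qs *\<^sub>R partials L (T (qs @ js)) y)" for L js
    by (simp add: partials_sum sm closed)
  have swap: "f (is @ qs @ ps) = f (is @ ps @ qs)" for "is" ps qs
    by (rule symmetric_schwartzD(1)[OF f]) simp
  have "(contract \<eta> ^^ j) ((tensor_dirderiv \<eta> ^^ l) h) [] x =
      (\<Sum>ps1 | length ps1 = j. weight \<eta> ps1 *\<^sub>R (\<Sum>ps2 | length ps2 = l. weight \<eta> ps2 *\<^sub>R partials ps2 (h ps1) x))"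
    by (simp add: contract_power tensor_dirderiv_power closed)
  also have "\<dots> = (\<Sum>ps1 | length ps1 = j. \<Sum>ps2 | length ps2 = l. \<Sum>qs1 | length qs1 = l. \<Sum>qs2 | length qs2 = j. \<Sum>is | length is = k.
      (weight \<eta> (ps1 @ ps2) * weight \<xi> ((qs1 @ qs2) @ is)) *\<^sub>R partials (ps2 @ qs2) (f (is @ ps1 @ qs1)) x)"
    unfolding h T g swap scaleR_sum_right by (simp add: mult.assoc)
  finally show ?thesis by (simp only: h_def T_def g_def)
qed

text \<open>
  The \<open>l\<close>-th term of the binomial expansion contracts \<open>\<eta>\<close> into \<open>r - l\<close> slots of \<open>f\<close> and \<open>l\<close> derivatives, and
  \<open>\<xi>\<close> into \<open>l + k\<close> slots and \<open>r - l\<close> derivatives, exactly as the indices \<open>p\<close>, \<open>q\<close> and \<open>i\<close> are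
  distributed in the \<open>l\<close>-th term of the Saint Venant sum.
\<close>

theorem saint_venant_sum_contraction:
  assumes f: "f \<in> symmetric_schwartz"
  shows "(\<Sum>ps | length ps = r. \<Sum>rs | length rs = r + k.
      (weight \<eta> ps * weight \<xi> rs) *\<^sub>R saint_venant_sum (r + k) k f ps (take r rs) (drop r rs) x) =
    (contract \<xi> ^^ k) ((plane_curl \<eta> \<xi> ^^ r) f) [] x"
proof -
  define c where "c l = (- 1) ^ l * real (r choose l)" for l
  define P where "P l ps qs is = partials (drop (r - l) ps @ drop l qs) (f (is @ take (r - l) ps @ take l qs)) x" for l ps qs "is"
  define T where "T l = (tensor_dirderiv \<eta> ^^ l) ((contract \<xi> ^^ l) ((tensor_dirderiv \<xi> ^^ (r - l)) ((contract \<eta> ^^ (r - l)) f)))" for l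
  have T: "(contract \<xi> ^^ k) (T l) [] x = (\<Sum>ps | length ps = r. \<Sum>rs | length rs = r + k.
      (weight \<eta> ps * weight \<xi> rs) *\<^sub>R P l ps (take r rs) (drop r rs))" if l: "l \<le> r" for l
  proof -
    define j where "j = r - l"
    have r: "r = j + l" "r = l + j" using l by (auto simp: j_def)
    note cl = contract_power_closed tensor_dirderiv_power_closed f
    have "(contract \<xi> ^^ k) (T l) =
        (tensor_dirderiv \<eta> ^^ l) ((contract \<xi> ^^ l) ((tensor_dirderiv \<xi> ^^ j) ((contract \<eta> ^^ j) ((contract \<xi> ^^ k) f))))"
      unfolding T_def j_def[symmetric]
      by (simp only: contract_power_tensor_dirderiv_power contract_power_contract_power[where v = \<xi> and i = k] cl)
    also have "\<dots> = (contract \<eta> ^^ j) ((tensor_dirderiv \<eta> ^^ l) ((contract \<xi> ^^ l) ((tensor_dirderiv \<xi> ^^ j) ((contract \<xi> ^^ k) f))))"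
      by (simp only: contract_power_tensor_dirderiv_power contract_power_contract_power[where v = \<eta> and i = j and w = \<xi> and j = l] cl)
    finally have "(contract \<xi> ^^ k) (T l) [] x =
      (\<Sum>ps1 | length ps1 = j. \<Sum>ps2 | length ps2 = l. \<Sum>qs1 | length qs1 = l. \<Sum>qs2 | length qs2 = j. \<Sum>is | length is = k.
      (weight \<eta> (ps1 @ ps2) * weight \<xi> ((qs1 @ qs2) @ is)) *\<^sub>R partials (ps2 @ qs2) (f (is @ ps1 @ qs1)) x)"
      by (simp only: partials_contraction[OF f])
    also have "\<dots> = (\<Sum>ps1 | length ps1 = j. \<Sum>ps2 | length ps2 = l. \<Sum>qs1 | length qs1 = l. \<Sum>qs2 | length qs2 = j. \<Sum>is | length is = k.
      (weight \<eta> (ps1 @ ps2) * weight \<xi> ((qs1 @ qs2) @ is)) *\<^sub>R P l (ps1 @ ps2) (take r ((qs1 @ qs2) @ is)) (drop r ((qs1 @ qs2) @ is)))"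
      by (intro sum.cong refl) (auto simp: P_def r(1))
    also have "\<dots> = (\<Sum>ps1 | length ps1 = j. \<Sum>ps2 | length ps2 = l. \<Sum>qs | length qs = l + j. \<Sum>is | length is = k.
      (weight \<eta> (ps1 @ ps2) * weight \<xi> (qs @ is)) *\<^sub>R P l (ps1 @ ps2) (take r (qs @ is)) (drop r (qs @ is)))"
      by (simp only: sum_lists_add)
    also have "\<dots> = (\<Sum>ps | length ps = j + l. \<Sum>rs | length rs = l + j + k.
      (weight \<eta> ps * weight \<xi> rs) *\<^sub>R P l ps (take r rs) (drop r rs))"
      by (simp only: sum_lists_add)
    finally show ?thesis by (simp only: r[symmetric])
  qed
  have "(contract \<xi> ^^ k) ((plane_curl \<eta> \<xi> ^^ r) f) [] x = (\<Sum>is | length is = k. weight \<xi> is *\<^sub>R (\<Sum>l\<le>r. c l *\<^sub>R T l is x))"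
    by (simp add: contract_power plane_curl_power_binomial[OF f] T_def c_def)
  also have "\<dots> = (\<Sum>l\<le>r. c l *\<^sub>R (contract \<xi> ^^ k) (T l) [] x)"
    unfolding contract_power scaleR_sum_right by (subst sum.swap) (simp add: mult.commute)
  also have "\<dots> = (\<Sum>l\<le>r. \<Sum>ps | length ps = r. \<Sum>rs | length rs = r + k.
      (weight \<eta> ps * weight \<xi> rs) *\<^sub>R c l *\<^sub>R P l ps (take r rs) (drop r rs))"
    by (simp add: T scaleR_sum_right mult.commute)
  also have "\<dots> = (\<Sum>ps | length ps = r. \<Sum>rs | length rs = r + k. \<Sum>l\<le>r.
      (weight \<eta> ps * weight \<xi> rs) *\<^sub>R c l *\<^sub>R P l ps (take r rs) (drop r rs))"
    by (simp only: sum.swap[of _ _ "{..r}"])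
  also have "\<dots> = (\<Sum>ps | length ps = r. \<Sum>rs | length rs = r + k.
      (weight \<eta> ps * weight \<xi> rs) *\<^sub>R saint_venant_sum (r + k) k f ps (take r rs) (drop r rs) x)"
    by (simp add: saint_venant_sum_def c_def P_def scaleR_sum_right)
  finally show ?thesis by simp
qed

section \<open>Equality of the kernels\<close>

lemma moment_transform_eq_line_moment:
  "moment_transform m q f (x, \<xi>) = line_moment q ((contract \<xi> ^^ m) f []) x \<xi>"
  unfolding moment_transform_def line_moment_def by (simp add: contract_power weight_def)

text \<open>
  Reparametrize the line with base point moved by \<open>b\<close> and speed \<open>a\<close>, and expand \<open>(t - b)\<^sup>q\<close>. Moments
  of all lower orders enter, which is why the moments up to \<open>k\<close> have to be considered together.
\<close>

lemma line_moment_rescale: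
  fixes u :: "real ^ 'n::finite \<Rightarrow> 'a::euclidean_space"
  assumes u: "schwartz u" and a: "a > 0" and \<xi>: "\<xi> \<noteq> 0"
  shows "line_moment q u x (a *\<^sub>R \<xi>) =
    (1 / a ^ Suc q) *\<^sub>R (\<Sum>j\<le>q. (real (q choose j) * (- b) ^ (q - j)) *\<^sub>R line_moment j u (x - b *\<^sub>R \<xi>) \<xi>)"
proof -
  let ?y = "x - b *\<^sub>R \<xi>"
  let ?h = "\<lambda>t. ((t - b) / a) ^ q *\<^sub>R u (?y + t *\<^sub>R \<xi>)"
  have "integral\<^sup>L lborel ?h = \<bar>a\<bar> *\<^sub>R (\<integral>t. ?h (b + a * t) \<partial>lborel)"
    by (rule lborel_integral_real_affine) (use a in simp)
  also have "(\<integral>t. ?h (b + a * t) \<partial>lborel) = line_moment q u x (a *\<^sub>R \<xi>)"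
    using a by (simp add: line_moment_def algebra_simps)
  finally have "line_moment q u x (a *\<^sub>R \<xi>) = (1 / a) *\<^sub>R integral\<^sup>L lborel ?h"
    using a by simp
  also have "?h = (\<lambda>t. (1 / a ^ q) *\<^sub>R (\<Sum>j\<le>q. (real (q choose j) * (- b) ^ (q - j)) *\<^sub>R (t ^ j *\<^sub>R u (?y + t *\<^sub>R \<xi>))))"
  proof
    fix t
    have "(t - b) ^ q = (\<Sum>j\<le>q. real (q choose j) * (- b) ^ (q - j) * t ^ j)"
      using binomial_ring[of t "- b" q] by (simp add: mult_ac)
    then show "?h t = (1 / a ^ q) *\<^sub>R (\<Sum>j\<le>q. (real (q choose j) * (- b) ^ (q - j)) *\<^sub>R (t ^ j *\<^sub>R u (?y + t *\<^sub>R \<xi>)))"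
      by (simp add: power_divide scaleR_sum_left scaleR_sum_right sum_divide_distrib)
  qed
  also have "integral\<^sup>L lborel \<dots> = (1 / a ^ q) *\<^sub>R (\<Sum>j\<le>q. (real (q choose j) * (- b) ^ (q - j)) *\<^sub>R line_moment j u ?y \<xi>)"
    unfolding line_moment_def
    by (simp only: integral_scaleR_right
      Bochner_Integration.integral_sum[OF integrable_scaleR_right[OF line_moment_integrable[OF u \<xi>]]])
  finally show ?thesis by simp
qed

lemma weight_scaleR: "weight (a *\<^sub>R v) is = a ^ length is * weight v is"
  by (induction "is") auto

lemma contract_power_scaleR: "(contract (a *\<^sub>R v) ^^ m) f js = (\<lambda>x. a ^ m *\<^sub>R (contract v ^^ m) f js x)"
  by (auto simp: fun_eq_iff contract_power weight_scaleR scaleR_sum_right intro!: sum.cong)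

lemma line_moment_scaleR: "line_moment q (\<lambda>x. a *\<^sub>R u x) x \<theta> = a *\<^sub>R line_moment q u x \<theta>"
proof -
  have "line_moment q (\<lambda>x. a *\<^sub>R u x) x \<theta> = (\<integral>t. a *\<^sub>R (t ^ q *\<^sub>R u (x + t *\<^sub>R \<theta>)) \<partial>lborel)"
    unfolding line_moment_def by (simp add: mult.commute)
  then show ?thesis unfolding line_moment_def by (simp only: integral_scaleR_right)
qed

text \<open>
  Every line has a parametrization by arc length starting from the point closest to the origin,
  and that point and direction belong to the tangent sphere bundle.
\<close>

lemma moments_vanish_iff_all_lines:
  fixes f :: "('n::finite, 'a::{real_normed_field, euclidean_space}) tensor_field"
  assumes f: "f \<in> symmetric_schwartz"
  shows "(\<forall>q\<le>k. \<forall>p\<in>tangent_sphere. moment_transform m q f p = 0) \<longleftrightarrow>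
    (\<forall>q\<le>k. \<forall>x \<theta>. \<theta> \<noteq> 0 \<longrightarrow> line_moment q ((contract \<theta> ^^ m) f []) x \<theta> = 0)"
proof (intro iffI allI impI ballI)
  fix q x and \<theta> :: "real ^ 'n"
  assume zero: "\<forall>q\<le>k. \<forall>p\<in>tangent_sphere. moment_transform m q f p = 0" and q: "q \<le> k" and \<theta>: "\<theta> \<noteq> 0"
  define a where "a = norm \<theta>"
  define \<xi> where "\<xi> = (1 / a) *\<^sub>R \<theta>"
  have a: "a > 0" and \<theta>_eq: "\<theta> = a *\<^sub>R \<xi>" and \<xi>: "norm \<xi> = 1" "\<xi> \<noteq> 0"
    using \<theta> by (auto simp: a_def \<xi>_def)
  let ?y = "x - (x \<bullet> \<xi>) *\<^sub>R \<xi>"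
  have "?y \<bullet> \<xi> = 0" using \<xi>(1) by (simp add: inner_diff_left dot_square_norm)
  then have "(?y, \<xi>) \<in> tangent_sphere" using \<xi>(1) by (simp add: tangent_sphere_def)
  then have "line_moment j ((contract \<xi> ^^ m) f []) ?y \<xi> = 0" if "j \<le> q" for j
    using zero that q by (simp add: moment_transform_eq_line_moment[symmetric])
  then have "line_moment q ((contract \<xi> ^^ m) f []) x \<theta> = 0"
    unfolding \<theta>_eq
    by (subst line_moment_rescale[OF symmetric_schwartzD(2)[OF contract_power_closed[OF f]] a \<xi>(2), where b = "x \<bullet> \<xi>"]) simp
  then show "line_moment q ((contract \<theta> ^^ m) f []) x \<theta> = 0"
    by (simp add: \<theta>_eq contract_power_scaleR line_moment_scaleR)
next
  fix q and p :: "(real ^ 'n) \<times> (real ^ 'n)"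
  assume *: "\<forall>q\<le>k. \<forall>x \<theta>. \<theta> \<noteq> 0 \<longrightarrow> line_moment q ((contract \<theta> ^^ m) f []) x \<theta> = 0"
    and "q \<le> k" "p \<in> tangent_sphere"
  moreover obtain x \<xi> where p: "p = (x, \<xi>)" by (cases p)
  ultimately have "norm \<xi> = 1" by (simp add: tangent_sphere_def)
  then have "\<xi> \<noteq> 0" by auto
  with * \<open>q \<le> k\<close> show "moment_transform m q f p = 0"
    by (simp add: p moment_transform_eq_line_moment)
qed

lemma plane_curl_swap:
  "plane_curl \<xi> \<eta> f = (\<lambda>is x. - plane_curl \<eta> \<xi> f is x)"
  by (simp add: plane_curl_def)

lemma plane_curl_scaleR:
  assumes "f \<in> symmetric_schwartz"
  shows "plane_curl \<eta> \<xi> (\<lambda>is x. a *\<^sub>R f is x) = (\<lambda>is x. a *\<^sub>R plane_curl \<eta> \<xi> f is x)"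
proof -
  have "contract v (\<lambda>is x. a *\<^sub>R f is x) = (\<lambda>is x. a *\<^sub>R contract v f is x)" for v
    by (simp add: contract_def scaleR_sum_right mult.commute)
  moreover have "dirderiv w (\<lambda>x. a *\<^sub>R contract v f is x) x = a *\<^sub>R dirderiv w (contract v f is) x" for v w "is" x
    using dirderiv_lincomb[of "contract v f is" "contract v f is" w a 0 x] assms
    by (simp add: schwartz_smooth symmetric_schwartzD(2) contract_closed)
  ultimately show ?thesis
    by (simp add: plane_curl_def tensor_dirderiv_def scaleR_diff_right)
qed

lemma plane_curl_power_swap:
  assumes "f \<in> symmetric_schwartz"
  shows "(plane_curl \<xi> \<eta> ^^ r) f = (\<lambda>is x. (- 1) ^ r *\<^sub>R (plane_curl \<eta> \<xi> ^^ r) f is x)"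
proof (induction r)
  case (Suc r)
  then show ?case
    by (simp add: plane_curl_scaleR plane_curl_power_closed assms plane_curl_swap[of \<xi> \<eta>])
qed simp

lemma plane_curl_power_shear:
  "f \<in> symmetric_schwartz \<Longrightarrow> (plane_curl \<eta> (\<xi> + c *\<^sub>R \<eta>) ^^ r) f = (plane_curl \<eta> \<xi> ^^ r) f"
  by (induction r) (simp_all add: plane_curl_shear plane_curl_power_closed)

text \<open>
  The only place where the dimension matters.
\<close>

lemma exists_noncollinear:
  fixes \<xi> :: "'b::euclidean_space"
  assumes "DIM('b) \<ge> 2" "\<xi> \<noteq> 0"
  shows "\<exists>v. noncollinear v \<xi>"
proof -
  have "dim (span {\<xi>}) < DIM('b)"
    using assms(1) dim_le_card[of "{\<xi>}" "{\<xi>}"] by simp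
  then have "span {\<xi>} \<noteq> UNIV" by (metis dim_UNIV less_irrefl)
  then obtain v where v: "v \<notin> span {\<xi>}" by blast
  have "a = 0 \<and> b = 0" if eq: "a *\<^sub>R v + b *\<^sub>R \<xi> = 0" for a b
  proof -
    have "a = 0"
    proof (rule ccontr)
      assume a: "a \<noteq> 0"
      have "a *\<^sub>R v = (- b) *\<^sub>R \<xi>" using eq by (simp add: add_eq_0_iff2)
      then have "v = (- b / a) *\<^sub>R \<xi>" using a by (metis divideR_right scaleR_scaleR divide_inverse mult.commute)
      then show False using v by (metis span_base span_mul singletonI)
    qed
    with eq assms(2) show ?thesis by simp
  qed
  then show ?thesis unfolding noncollinear_def by blast
qed

lemma noncollinear_perturbation:
  assumes v: "noncollinear v \<xi>" and \<eta>: "\<not> noncollinear \<eta> \<xi>" and \<epsilon>: "\<epsilon> \<noteq> 0"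
  shows "noncollinear (\<eta> + \<epsilon> *\<^sub>R v) \<xi>"
  unfolding noncollinear_def
proof (intro allI impI)
  fix a b
  assume eq: "a *\<^sub>R (\<eta> + \<epsilon> *\<^sub>R v) + b *\<^sub>R \<xi> = 0"
  obtain c d where cd: "c *\<^sub>R \<eta> + d *\<^sub>R \<xi> = 0" "c \<noteq> 0 \<or> d \<noteq> 0"
    using \<eta> unfolding noncollinear_def by blast
  have "c \<noteq> 0" using cd noncollinear_nonzero[OF v] by auto
  have "0 = c *\<^sub>R (a *\<^sub>R (\<eta> + \<epsilon> *\<^sub>R v) + b *\<^sub>R \<xi>) - a *\<^sub>R (c *\<^sub>R \<eta> + d *\<^sub>R \<xi>)"
    using eq cd by simp
  also have "\<dots> = (c * a * \<epsilon>) *\<^sub>R v + (c * b - a * d) *\<^sub>R \<xi>" by (simp add: algebra_simps)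
  finally have "c * a * \<epsilon> = 0 \<and> c * b - a * d = 0" using v unfolding noncollinear_def by metis
  then show "a = 0 \<and> b = 0" using \<open>c \<noteq> 0\<close> \<epsilon> by auto
qed

lemma weight_pencil_tendsto: "((\<lambda>\<epsilon>. weight (v + \<epsilon> *\<^sub>R w) is) \<longlongrightarrow> weight v is) (at 0)"
proof -
  have "isCont (\<lambda>\<epsilon>. weight (v + \<epsilon> *\<^sub>R w) is) 0"
    by (induction "is") (auto intro!: continuous_intros)
  then show ?thesis by (simp add: isCont_def)
qed

text \<open>
  \<open>Q\<close> is a polynomial, and independent pairs are dense. The limit is taken in two steps: first \<open>\<eta>\<close> is
  perturbed while \<open>\<xi> \<noteq> 0\<close> is fixed, then \<open>\<xi>\<close> is allowed to be zero.
\<close>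

lemma zero_on_noncollinear_imp_zero:
  fixes G :: "'n::finite list \<Rightarrow> 'n list \<Rightarrow> 'a::real_normed_vector" and M N :: nat
  defines "Q \<equiv> \<lambda>\<eta> \<xi>. \<Sum>ps | length ps = M. \<Sum>rs | length rs = N. (weight \<eta> ps * weight \<xi> rs) *\<^sub>R G ps rs"
  assumes card: "CARD('n) \<ge> 2" and zero: "\<And>\<eta> \<xi>. noncollinear \<eta> \<xi> \<Longrightarrow> Q \<eta> \<xi> = 0"
  shows "Q \<eta> \<xi> = 0"
proof -
  have dim: "DIM(real ^ 'n) \<ge> 2" using card by simp
  have nonzero: "Q \<eta> \<xi> = 0" if \<xi>: "\<xi> \<noteq> 0" for \<eta> \<xi>
  proof (cases "noncollinear \<eta> \<xi>")
    case False
    obtain v where v: "noncollinear v \<xi>" using exists_noncollinear[OF dim \<xi>] by blast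
    have "((\<lambda>\<epsilon>. Q (\<eta> + \<epsilon> *\<^sub>R v) \<xi>) \<longlongrightarrow> Q \<eta> \<xi>) (at 0)"
      unfolding Q_def by (intro tendsto_intros weight_pencil_tendsto)
    moreover have "((\<lambda>\<epsilon>. Q (\<eta> + \<epsilon> *\<^sub>R v) \<xi>) \<longlongrightarrow> 0) (at 0)"
      by (rule tendsto_eventually) (simp add: eventually_at_filter zero noncollinear_perturbation[OF v False])
    ultimately show ?thesis by (rule tendsto_unique[OF at_neq_bot])
  qed (rule zero)
  show ?thesis
  proof (cases "\<xi> = 0")
    case True
    obtain w :: "real ^ 'n" where w: "w \<noteq> 0" using nonzero_Basis by blast
    have "((\<lambda>\<epsilon>. Q \<eta> (\<xi> + \<epsilon> *\<^sub>R w)) \<longlongrightarrow> Q \<eta> \<xi>) (at 0)"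
      unfolding Q_def by (intro tendsto_intros weight_pencil_tendsto)
    moreover have "((\<lambda>\<epsilon>. Q \<eta> (\<xi> + \<epsilon> *\<^sub>R w)) \<longlongrightarrow> 0) (at 0)"
      by (rule tendsto_eventually) (simp add: eventually_at_filter True w nonzero)
    ultimately show ?thesis by (rule tendsto_unique[OF at_neq_bot])
  qed (rule nonzero)
qed

text \<open>
  From moments to curls, the pencil \<open>\<eta> + c \<xi>\<close> is used, so that filling the slots with the shear
  vector of the pencil means filling them with \<open>\<xi>\<close>; the roles of \<open>\<eta>\<close> and \<open>\<xi>\<close> in the curl are then
  exchanged back at the cost of a sign. From curls to moments, the direction \<open>\<theta>\<close> of a given line is
  completed to a pencil by an arbitrary independent vector.
\<close>

theorem moments_vanish_iff_curl_contractions_vanish: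
  fixes f :: "('n::finite, 'a::euclidean_space) tensor_field"
  assumes card: "CARD('n) \<ge> 2" and f: "f \<in> symmetric_schwartz"
  shows "(\<forall>q\<le>k. \<forall>x \<theta>. \<theta> \<noteq> 0 \<longrightarrow> line_moment q ((contract \<theta> ^^ (r + k)) f []) x \<theta> = 0) \<longleftrightarrow>
    (\<forall>\<eta> \<xi> x. noncollinear \<eta> \<xi> \<longrightarrow> (contract \<xi> ^^ k) ((plane_curl \<eta> \<xi> ^^ r) f) [] x = 0)" (is "?moments \<longleftrightarrow> ?curls")
proof (intro iffI allI impI)
  fix \<eta> \<xi> :: "real ^ 'n" and x
  assume moments: ?moments and "noncollinear \<eta> \<xi>"
  then have nc: "noncollinear \<xi> \<eta>" by (simp add: noncollinear_commute)
  let ?g = "(plane_curl \<xi> \<eta> ^^ r) f"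
  have g: "?g \<in> symmetric_schwartz" by (rule plane_curl_power_closed[OF f])
  have "\<forall>q\<le>k. pencil_moments_vanish q (r + k) \<xi> \<eta> f"
    unfolding pencil_moments_vanish_def
    using moments noncollinear_nonzero[OF noncollinear_shear[OF nc]] by blast
  then have "\<forall>q\<le>k. pencil_moments_vanish q k \<xi> \<eta> ?g"
    using pencil_moments_vanish_iff_plane_curl_power[OF f nc order_refl] by blast
  then have "pencil_moments_vanish 0 0 \<xi> \<eta> ((contract \<xi> ^^ k) ?g)"
    by (intro pencil_moments_vanish_contract_power[OF g nc]) blast
  then have "(contract \<xi> ^^ k) ?g [] x = 0"
    by (intro plane_xray_injective[OF symmetric_schwartzD(2)[OF contract_power_closed[OF g]] nc])
      (simp add: pencil_moments_vanish_def)
  moreover have "(contract \<xi> ^^ k) ?g [] x = (- 1) ^ r *\<^sub>R (contract \<xi> ^^ k) ((plane_curl \<eta> \<xi> ^^ r) f) [] x"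
    unfolding plane_curl_power_swap[OF f, where \<xi> = \<xi> and \<eta> = \<eta> and r = r] contract_power scaleR_sum_right
    by (simp add: mult.commute)
  ultimately show "(contract \<xi> ^^ k) ((plane_curl \<eta> \<xi> ^^ r) f) [] x = 0" by simp
next
  fix q x and \<theta> :: "real ^ 'n"
  assume curls: ?curls and q: "q \<le> k" and \<theta>: "\<theta> \<noteq> 0"
  obtain \<eta> where nc: "noncollinear \<eta> \<theta>"
    using exists_noncollinear[OF _ \<theta>] card by auto
  have "pencil_moments_vanish p k \<eta> \<theta> ((plane_curl \<eta> \<theta> ^^ r) f)" for p
    unfolding pencil_moments_vanish_def
  proof (intro allI)
    fix c x
    have "(contract (\<theta> + c *\<^sub>R \<eta>) ^^ k) ((plane_curl \<eta> \<theta> ^^ r) f) [] y = 0" for y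
      using curls noncollinear_shear[OF nc, of c] plane_curl_power_shear[OF f, where \<eta> = \<eta> and \<xi> = \<theta> and c = c and r = r] by metis
    then show "line_moment p ((contract (\<theta> + c *\<^sub>R \<eta>) ^^ k) ((plane_curl \<eta> \<theta> ^^ r) f) []) x (\<theta> + c *\<^sub>R \<eta>) = 0"
      by (simp add: line_moment_def)
  qed
  then have "pencil_moments_vanish q (r + k) \<eta> \<theta> f"
    using pencil_moments_vanish_iff_plane_curl_power[OF f nc order_refl, where r = r] q by blast
  then show "line_moment q ((contract \<theta> ^^ (r + k)) f []) x \<theta> = 0"
    unfolding pencil_moments_vanish_def by (metis add.right_neutral scaleR_zero_left)
qed

lemma saint_venant_vanishes_iff_curl_contractions_vanish:
  fixes f :: "('n::finite, 'a::euclidean_space) tensor_field"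
  assumes card: "CARD('n) \<ge> 2" and f: "f \<in> symmetric_schwartz"
  shows "(\<forall>ps qs is. length ps = r \<longrightarrow> length qs = r \<longrightarrow> length is = k \<longrightarrow> saint_venant (r + k) k f ps qs is x = 0) \<longleftrightarrow>
    (\<forall>\<eta> \<xi>. noncollinear \<eta> \<xi> \<longrightarrow> (contract \<xi> ^^ k) ((plane_curl \<eta> \<xi> ^^ r) f) [] x = 0)"
proof -
  let ?G = "\<lambda>ps rs. saint_venant_sum (r + k) k f ps (take r rs) (drop r rs) x"
  have "(\<forall>ps qs is. length ps = r \<longrightarrow> length qs = r \<longrightarrow> length is = k \<longrightarrow> saint_venant (r + k) k f ps qs is x = 0) \<longleftrightarrow>
      (\<forall>ps rs. length ps = r \<longrightarrow> length rs = r + k \<longrightarrow> symmetrize (\<lambda>ps'. symmetrize (?G ps') rs) ps = 0)" (is "?L \<longleftrightarrow> ?R")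
  proof
    assume L: ?L
    show ?R
    proof (intro allI impI)
      fix ps rs :: "'n list"
      assume "length ps = r" "length rs = r + k"
      then show "symmetrize (\<lambda>ps'. symmetrize (?G ps') rs) ps = 0"
        using L[rule_format, of ps "take r rs" "drop r rs"] by (simp add: saint_venant_def)
    qed
  next
    assume ?R
    then show ?L by (simp add: saint_venant_def)
  qed
  also have "\<dots> \<longleftrightarrow> (\<forall>\<eta> \<xi>. (contract \<xi> ^^ k) ((plane_curl \<eta> \<xi> ^^ r) f) [] x = 0)"
    unfolding bipolarization[symmetric] saint_venant_sum_contraction[OF f] ..
  also have "\<dots> \<longleftrightarrow> (\<forall>\<eta> \<xi>. noncollinear \<eta> \<xi> \<longrightarrow> (contract \<xi> ^^ k) ((plane_curl \<eta> \<xi> ^^ r) f) [] x = 0)"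
    using zero_on_noncollinear_imp_zero[OF card, where M = r and N = "r + k" and G = ?G]
    unfolding saint_venant_sum_contraction[OF f] by blast
  finally show ?thesis .
qed

lemma symmetrize_cong:
  "(\<And>bs. length bs = length as \<Longrightarrow> F bs = G bs) \<Longrightarrow> symmetrize F as = symmetrize G as"
  unfolding symmetrize_def by simp

text \<open>
  Components at index lists of the wrong length are arbitrary in \<open>f\<close>; setting them to zero makes
  the field symmetric and Schwartz in all ranks.
\<close>

lemma zero_extension_symmetric_schwartz:
  assumes f: "f \<in> schwartz_tensor_fields m"
  shows "(\<lambda>is. if length is = m then f is else (\<lambda>x. 0)) \<in> symmetric_schwartz"
proof (rule symmetric_schwartzI)
  fix "is" js :: "'a list"
  assume eq: "mset is = mset js"
  then have len: "length is = length js" by (rule mset_eq_length)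
  obtain \<pi> where "\<pi> permutes {..<length js}" "permute_list \<pi> js = is"
    by (rule mset_eq_permutation[OF eq])
  then show "(if length is = m then f is else (\<lambda>x. 0)) = (if length js = m then f js else (\<lambda>x. 0))"
    using f len unfolding schwartz_tensor_fields_def symmetric_tensor_def by auto
next
  show "schwartz (if length is = m then f is else (\<lambda>x. 0))" for "is"
    using f by (auto simp: schwartz_tensor_fields_def schwartz_zero)
qed

theorem theorem3p1:
  fixes f :: "('n::finite, 'a::{real_normed_field, euclidean_space}) tensor_field"
    and m k :: nat
  assumes "CARD('n) \<ge> 2"
    and "k \<le> m"
    and "f \<in> schwartz_tensor_fields m"
  shows "(\<forall>q\<le>k. \<forall>p\<in>tangent_sphere. moment_transform m q f p = 0) \<longleftrightarrow>
         (\<forall>ps qs is x. length ps = m - k \<longrightarrow> length qs = m - k \<longrightarrow> length is = k \<longrightarrow>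
            saint_venant m k f ps qs is x = 0)"
proof -
  define g where "g = (\<lambda>is. if length is = m then f is else (\<lambda>x. 0))"
  have g: "g \<in> symmetric_schwartz"
    unfolding g_def by (rule zero_extension_symmetric_schwartz) fact
  define r where "r = m - k"
  have m: "m = r + k" using assms(2) by (simp add: r_def)
  have I: "moment_transform m q f = moment_transform m q g" for q
    by (simp add: moment_transform_def g_def)
  have "saint_venant_sum m k f ps qs is x = saint_venant_sum m k g ps qs is x"
    if "length ps = r" "length qs = r" "length is = k" for ps qs "is" x
    using that unfolding saint_venant_sum_def by (intro sum.cong) (auto simp: g_def m)
  then have W: "saint_venant m k f ps qs is x = saint_venant m k g ps qs is x"
    if "length ps = r" "length qs = r" "length is = k" for ps qs "is" x
    using that unfolding saint_venant_def by (intro symmetrize_cong) (simp add: m)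
  have "(\<forall>q\<le>k. \<forall>p\<in>tangent_sphere. moment_transform m q f p = 0) \<longleftrightarrow>
      (\<forall>\<eta> \<xi> x. noncollinear \<eta> \<xi> \<longrightarrow> (contract \<xi> ^^ k) ((plane_curl \<eta> \<xi> ^^ r) g) [] x = 0)"
    unfolding I moments_vanish_iff_all_lines[OF g] unfolding m
    by (rule moments_vanish_iff_curl_contractions_vanish[OF assms(1) g])
  also have "\<dots> \<longleftrightarrow> (\<forall>ps qs is x. length ps = r \<longrightarrow> length qs = r \<longrightarrow> length is = k \<longrightarrow> saint_venant m k g ps qs is x = 0)"
    using saint_venant_vanishes_iff_curl_contractions_vanish[OF assms(1) g, of r k] unfolding m by blast
  also have "\<dots> \<longleftrightarrow> (\<forall>ps qs is x. length ps = r \<longrightarrow> length qs = r \<longrightarrow> length is = k \<longrightarrow> saint_venant m k f ps qs is x = 0)"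
    using W by auto
  finally show ?thesis by (simp only: r_def)
qed

end
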